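(* There is a universal constant $k<\infty$ such that for every finite or infinite sequence $Z$ of distinct points in the upper half-plane, $$M(Z)\le k\, c_{HJ}(Z).$$ The best possible (i.e. smallest) such constant $k$ lies in the interval $[\pi/\log 4,\ e]=[2.2662\ldots,\,2.7183\ldots]$.
   Context: Let $\mathbb{H}=\{z\in\mathbb{C}:\operatorname{Im} z>0\}$ and let $H^\infty$ be the space of bounded analytic functions on $\mathbb{H}$ with the supremum norm $\|\cdot\|_\infty$. Let $Z=(z_j)$, $j=1,2,\ldots$, be a finite or infinite (nonempty) sequence of distinct points $z_j=x_j+iy_j\in\mathbb{H}$. Constant of interpolation. $Z$ is an interpolating sequence if for each bounded sequence $(w_j)$ of complex numbers there is $f\in H^\infty$ with $f(z_j)=w_j$ for all $j$. If $Z$ is interpolating, $M(Z)$ is the smallest constant $C<\infty$ such that for every bounded sequence $(w_j)$ the problem $f(z_j)=w_j$ for all $j$ can be solved with $f\in H^\infty$ satisfying $\|f\|_\infty\le C\|(w_j)\|_\infty$, where $\|(w_j)\|_\infty=\sup_j|w_j|$. If $Z$ is not interpolating, $M(Z)=+\infty$. Blaschke factors. Let $B$ be the Blaschke product with zeros $Z$ and $B_j(z)=\frac{z-\overline{z_j}}{z-z_j}B(z)$, so that $$|B_j(z_j)|=\prod_{k\ne j}\left|\frac{z_j-z_k}{z_j-\overline{z_k}}\right|\in[0,1]$$ (empty product equal to $1$). The quantity $|B_j(z_j)|$ is understood as this product for every $Z$, with the convention $1/0=+\infty$. The characteristic $c_{HJ}(Z)$ is $$c_{HJ}(Z)=\sup_n\sum_{j:\,y_j\le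 y_n}\frac{4y_j(y_j+y_n)}{|z_j-\overline{z_n}|^2}\,\frac{1}{|B_j(z_j)|}\in(0,+\infty].$$ *)

theory Defs
  imports "HOL-Complex_Analysis.Complex_Analysis"
begin

definition upper_half_plane :: "complex set" where
  "upper_half_plane = {z. Im z > 0}"

text \<open>
  A finite or infinite sequence is a function \<open>z\<close> together with its length
  \<open>N\<close>, where \<open>N = \<infinity>\<close> means that the sequence is infinite. Values of \<open>z\<close>
  outside \<open>indices N\<close> are irrelevant.
\<close>

definition indices :: "enat \<Rightarrow> nat set" where
  "indices N = {j. enat j < N}"

definition point_sequence :: "enat \<Rightarrow> (nat \<Rightarrow> complex) \<Rightarrow> bool" where
  "point_sequence N z \<longleftrightarrow>
     N \<noteq> 0 \<and> inj_on z (indices N) \<and> z ` indices N \<subseteq> upper_half_plane"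

definition H_infinity :: "(complex \<Rightarrow> complex) set" where
  "H_infinity = {f. f holomorphic_on upper_half_plane \<and> bounded (f ` upper_half_plane)}"

definition H_infinity_norm :: "(complex \<Rightarrow> complex) \<Rightarrow> real" where
  "H_infinity_norm f = (SUP \<zeta>\<in>upper_half_plane. norm (f \<zeta>))"

definition interpolating :: "enat \<Rightarrow> (nat \<Rightarrow> complex) \<Rightarrow> bool" where
  "interpolating N z \<longleftrightarrow>
     (\<forall>w :: nat \<Rightarrow> complex. bounded (w ` indices N) \<longrightarrow>
       (\<exists>f\<in>H_infinity. \<forall>j\<in>indices N. f (z j) = w j))"

definition interpolation_bound :: "enat \<Rightarrow> (nat \<Rightarrow> complex) \<Rightarrow> real \<Rightarrow> bool" where
  "interpolation_bound N z C \<longleftrightarrow>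
     (\<forall>w :: nat \<Rightarrow> complex. bounded (w ` indices N) \<longrightarrow>
       (\<exists>f\<in>H_infinity. (\<forall>j\<in>indices N. f (z j) = w j) \<and>
          H_infinity_norm f \<le> C * (SUP j\<in>indices N. norm (w j))))"

text \<open>
  For an interpolating sequence the infimum is attained (Montel), so it is the
  smallest admissible constant. Every admissible constant is at least \<open>1\<close>, so
  \<open>ennreal\<close> does not truncate.
\<close>

definition interpolation_constant :: "enat \<Rightarrow> (nat \<Rightarrow> complex) \<Rightarrow> ennreal" where
  "interpolation_constant N z =
     (if interpolating N z then (INF C\<in>{C. interpolation_bound N z C}. ennreal C) else \<infinity>)"

text \<open>
  The modulus of the \<open>j\<close>-th Blaschke factor at \<open>z j\<close>, as the limit of its partial
  products. They are decreasing and lie in \<open>[0, 1]\<close>, so the limit exists, but it may be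
  \<open>0\<close>; this is why \<open>prodinf\<close>, which excludes products diverging to \<open>0\<close>, is not used.
\<close>

definition blaschke_abs :: "enat \<Rightarrow> (nat \<Rightarrow> complex) \<Rightarrow> nat \<Rightarrow> real" where
  "blaschke_abs N z j =
     lim (\<lambda>m. \<Prod>k\<in>{k \<in> indices N. k < m \<and> k \<noteq> j}. norm ((z j - z k) / (z j - cnj (z k))))"

text \<open>
  Division is taken in \<open>ennreal\<close>, where \<open>a / 0 = \<infinity>\<close> for \<open>a > 0\<close>.
\<close>

definition c_HJ :: "enat \<Rightarrow> (nat \<Rightarrow> complex) \<Rightarrow> ennreal" where
  "c_HJ N z =
     (SUP n\<in>indices N. \<Sum>\<^sub>\<infinity>j\<in>{j \<in> indices N. Im (z j) \<le> Im (z n)}.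
        ennreal (4 * Im (z j) * (Im (z j) + Im (z n)) / (norm (z j - cnj (z n)))\<^sup>2)
          * (1 / ennreal (blaschke_abs N z j)))"

definition HJ_constant :: "real \<Rightarrow> bool" where
  "HJ_constant k \<longleftrightarrow>
     (\<forall>N z. point_sequence N z \<longrightarrow> interpolation_constant N z \<le> ennreal k * c_HJ N z)"

end

theory Submission
  imports Defs
begin

text \<open>
  Upper bound. Jones' formula interpolates the unit vector at \<open>z\<^sub>n\<close> by
  \[ F_n(\zeta) = \frac{B_n(\zeta)}{B_n(z_n)}
       \left(\frac{2 i y_n}{\zeta - \overline{z_n}}\right)^2 \exp\frac{g_n(z_n) - g_n(\zeta)}{c}, \qquad
     g_n(\zeta) = \sum_{y_k \le y_n} \frac{4 y_k}{|B_k(z_k)|} \, \frac{i}{\zeta - \overline{z_k}}, \]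
  where \<open>c\<close> is the characteristic of the sequence. The real part of \<open>g\<^sub>n(z\<^sub>n)\<close> is exactly the sum
  that the characteristic bounds, so the factor \<open>exp (g\<^sub>n(z\<^sub>n) / c)\<close> has modulus at most \<open>e\<close>. Put
  \<open>t\<^sub>k = 4 y\<^sub>k\<^sup>2 / (|\<zeta> - cnj z\<^sub>k|\<^sup>2 |B\<^sub>k(z\<^sub>k)|)\<close>. Everywhere in the half-plane, \<open>|F\<^sub>n(\<zeta>)|\<close> is at most
  \<open>e t\<^sub>n exp (- (\<Sum> t\<^sub>k) / c)\<close>, summed over \<open>y\<^sub>k \<le> y\<^sub>n\<close>. When the points are ordered by height,
  the sum of these majorants over \<open>n\<close> is at most \<open>e\<close> times a lower Riemann sum of the integral of
  \<open>exp (- t / c)\<close> over \<open>t \<ge> 0\<close>, which is \<open>c\<close>. So finite problems are solvable with constant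
  \<open>e c\<close> (\<open>finite_Jones_interpolation\<close>), and Montel's theorem passes to infinite sequences
  (\<open>interpolation_bound_of_c_HJ\<close>).

  Lower bound. Take the points \<open>z\<^sub>j = i exp (l j)\<close> for \<open>j < N\<close>. The logarithm maps the half-plane to
  the strip \<open>0 < Im \<zeta> < \<pi>\<close> and the points to equally spaced points of its middle line. If \<open>f\<close> is
  bounded by \<open>C\<close> and takes at each point the value \<open>\<plusminus> 1\<close> with the sign of the derivative of
  \<open>B(exp \<zeta>)\<close>, then \<open>f(exp \<zeta>) / B(exp \<zeta>)\<close> has the residues \<open>2 / |B\<^sub>j(z\<^sub>j)|\<close>. Integrate over the boundary of a rectangle of length \<open>N l\<close>
  that nearly fills the strip: on the long sides \<open>|B|\<close> is close to \<open>1\<close>, and the short sides, halfway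
  between consecutive points, contribute an amount bounded independently of \<open>N\<close>. Hence \<open>4 \<pi> \<Sum> 1 / |B\<^sub>j(z\<^sub>j)|\<close>
  is at most \<open>C (2 N l + O(1))\<close> (\<open>sum_inverse_tanh_products_le\<close>). Let \<open>b\<close> be the value of \<open>1 / |B\<^sub>j(z\<^sub>j)|\<close>
  for the two-sided infinite progression. As \<open>N\<close> grows, the interpolation constant is asymptotically
  at least \<open>2 \<pi> b / l\<close>, whereas the characteristic is at most
  \<open>4 b \<Sum> 1 / (1 + exp (l k)) \<le> 4 b (1/2 + ln 2 / l)\<close> (\<open>c_HJ_geometric_le\<close>). As \<open>l\<close> tends to \<open>0\<close>
  the ratio tends to \<open>\<pi> / (2 ln 2) = \<pi> / ln 4\<close> (\<open>HJ_constant_ge\<close>).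

  The smallest constant exists because the admissible constants are closed under infima: for
  each sequence the condition on \<open>k\<close> is a closed one (\<open>HJ_constant_Inf\<close>).
\<close>

section \<open>Jones' interpolation formula for finitely many points\<close>

text \<open>
  A comparison with the integral of \<open>exp (- s t)\<close>. If the values of \<open>y\<close> are distinct, the left side is
  the lower Riemann sum for the partition of \<open>[0, \<Sum> t]\<close> into intervals of length \<open>t n\<close>, taken in
  increasing order of \<open>y\<close>. Ties in \<open>y\<close> only enlarge the inner sums and so decrease the left side.
\<close>

lemma ordered_exponential_sum_le:
  fixes t y :: "'a \<Rightarrow> real"
  assumes "finite A" and "s > 0" and "\<And>n. n \<in> A \<Longrightarrow> t n \<ge> 0"
  shows "(\<Sum>n\<in>A. t n * exp (- s * (\<Sum>k\<in>{k\<in>A. y k \<le> y n}. t k)))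
           \<le> (1 - exp (- s * (\<Sum>n\<in>A. t n))) / s"
  using assms(1,3)
proof (induction A rule: finite_ranking_induct[where f = y])
  case empty
  then show ?case by simp
next
  case (insert x S)
  show ?case
  proof (cases "x \<in> S")
    case True
    then show ?thesis using insert by (simp add: insert_absorb)
  next
    case False
    let ?T = "\<Sum>n\<in>S. t n"
    have tx: "t x \<ge> 0" using insert.prems by simp
    have top: "{k \<in> insert x S. y k \<le> y x} = insert x S"
      using insert.hyps by auto
    have "(\<Sum>n\<in>S. t n * exp (- s * (\<Sum>k\<in>{k\<in>insert x S. y k \<le> y n}. t k)))
            \<le> (\<Sum>n\<in>S. t n * exp (- s * (\<Sum>k\<in>{k\<in>S. y k \<le> y n}. t k)))"
    proof (intro sum_mono mult_left_mono)
      fix n assume n: "n \<in> S"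
      have "(\<Sum>k\<in>{k\<in>S. y k \<le> y n}. t k) \<le> (\<Sum>k\<in>{k\<in>insert x S. y k \<le> y n}. t k)"
        using insert.hyps insert.prems by (intro sum_mono2) auto
      then show "exp (- s * (\<Sum>k\<in>{k\<in>insert x S. y k \<le> y n}. t k))
                   \<le> exp (- s * (\<Sum>k\<in>{k\<in>S. y k \<le> y n}. t k))"
        using \<open>s > 0\<close> by simp
      show "t n \<ge> 0" using insert.prems n by simp
    qed
    also have "\<dots> \<le> (1 - exp (- s * ?T)) / s"
      using insert by simp
    finally have IH: "(\<Sum>n\<in>S. t n * exp (- s * (\<Sum>k\<in>{k\<in>insert x S. y k \<le> y n}. t k)))
            \<le> (1 - exp (- s * ?T)) / s" .
    have "s * t x * exp (- s * t x) \<le> 1 - exp (- s * t x)"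
    proof -
      have "(1 + s * t x) * exp (- s * t x) \<le> exp (s * t x) * exp (- s * t x)"
        by (intro mult_right_mono exp_ge_add_one_self) simp
      then show ?thesis by (simp add: algebra_simps exp_minus)
    qed
    then have "s * t x * exp (- s * t x) * exp (- s * ?T)
                 \<le> (1 - exp (- s * t x)) * exp (- s * ?T)"
      by (rule mult_right_mono) simp
    then have step: "t x * exp (- s * (t x + ?T))
                 \<le> (exp (- s * ?T) - exp (- s * (t x + ?T))) / s"
      using \<open>s > 0\<close> by (simp add: field_simps exp_add exp_diff exp_minus)
    have "(\<Sum>n\<in>insert x S. t n * exp (- s * (\<Sum>k\<in>{k\<in>insert x S. y k \<le> y n}. t k)))
            = t x * exp (- s * (t x + ?T))
              + (\<Sum>n\<in>S. t n * exp (- s * (\<Sum>k\<in>{k\<in>insert x S. y k \<le> y n}. t k)))"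
      unfolding sum.insert[OF \<open>finite S\<close> False] top by simp
    also have "\<dots> \<le> (exp (- s * ?T) - exp (- s * (t x + ?T))) / s + (1 - exp (- s * ?T)) / s"
      using step IH by (rule add_mono)
    also have "\<dots> = (1 - exp (- s * (\<Sum>n\<in>insert x S. t n))) / s"
      unfolding sum.insert[OF \<open>finite S\<close> False] by (simp add: diff_divide_distrib)
    finally show ?thesis .
  qed
qed

lemma diff_cnj_ne_0:
  assumes "Im \<zeta> > 0" "Im w > 0"
  shows "\<zeta> - cnj w \<noteq> 0"
  using assms by (auto simp: complex_eq_iff)

lemma blaschke_factor_norm_le_1:
  assumes "Im \<zeta> > 0" "Im w > 0"
  shows "norm ((\<zeta> - w) / (\<zeta> - cnj w)) \<le> 1"
proof -
  have "(norm (\<zeta> - w))\<^sup>2 \<le> (norm (\<zeta> - cnj w))\<^sup>2"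
    unfolding cmod_power2 using assms by (simp add: power2_eq_square algebra_simps)
  then have "norm (\<zeta> - w) \<le> norm (\<zeta> - cnj w)"
    by (rule power2_le_imp_le) simp
  then show ?thesis
    by (simp add: norm_divide divide_le_eq)
qed

text \<open>This kernel is what turns the sum in the characteristic into the real part of a holomorphic function.\<close>

lemma Re_half_plane_kernel:
  "Re (\<i> / (\<zeta> - cnj w)) = (Im \<zeta> + Im w) / (norm (\<zeta> - cnj w))\<^sup>2"
  by (simp add: Re_divide cmod_power2)

text \<open>
  The numbers \<open>b j\<close> are only required to dominate the reciprocals of the finite Blaschke products.
  This allows finite subsets of an infinite sequence to be treated with the
  Blaschke products of the whole sequence, and hence with one constant \<open>c\<close>.
\<close>

lemma finite_Jones_interpolation:
  fixes z w :: "'a \<Rightarrow> complex" and b :: "'a \<Rightarrow> real"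
  assumes fin: "finite A" and inj: "inj_on z A" and pos: "\<And>j. j \<in> A \<Longrightarrow> Im (z j) > 0"
    and b: "\<And>j. j \<in> A \<Longrightarrow> 1 \<le> b j * (\<Prod>k\<in>A - {j}. norm ((z j - z k) / (z j - cnj (z k))))"
    and c: "c > 0"
      "\<And>n. n \<in> A \<Longrightarrow> (\<Sum>j\<in>{j\<in>A. Im (z j) \<le> Im (z n)}.
         4 * Im (z j) * (Im (z j) + Im (z n)) / (norm (z j - cnj (z n)))\<^sup>2 * b j) \<le> c"
    and w: "\<And>j. j \<in> A \<Longrightarrow> norm (w j) \<le> W" "W \<ge> 0"
  obtains f where "f holomorphic_on upper_half_plane" "\<And>j. j \<in> A \<Longrightarrow> f (z j) = w j"
    "\<And>\<zeta>. Im \<zeta> > 0 \<Longrightarrow> norm (f \<zeta>) \<le> exp 1 * c * W"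
proof -
  define P where "P n \<zeta> = (\<Prod>k\<in>A - {n}. (\<zeta> - z k) / (\<zeta> - cnj (z k)))" for n \<zeta>
  define g where "g n \<zeta> = (\<Sum>k\<in>{k\<in>A. Im (z k) \<le> Im (z n)}.
      complex_of_real (4 * Im (z k) * b k) * (\<i> / (\<zeta> - cnj (z k))))" for n \<zeta>
  define F where "F n \<zeta> = P n \<zeta> / P n (z n) * (2 * \<i> * Im (z n) / (\<zeta> - cnj (z n)))\<^sup>2
      * exp ((g n (z n) - g n \<zeta>) / c)" for n \<zeta>
  define f where "f \<zeta> = (\<Sum>n\<in>A. w n * F n \<zeta>)" for \<zeta>
  have normP: "norm (P n (z n)) = (\<Prod>k\<in>A - {n}. norm ((z n - z k) / (z n - cnj (z k))))" for n
    by (simp add: P_def prod_norm)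
  have b0: "b j > 0" if "j \<in> A" for j
  proof (rule ccontr)
    assume "\<not> b j > 0"
    then have "b j * norm (P j (z j)) \<le> 0" by (simp add: mult_nonpos_nonneg)
    then show False using b[OF that] by (simp add: normP)
  qed
  have Re_g: "Re (g n \<zeta>) = (\<Sum>k\<in>{k\<in>A. Im (z k) \<le> Im (z n)}.
      4 * Im (z k) * b k * ((Im \<zeta> + Im (z k)) / (norm (\<zeta> - cnj (z k)))\<^sup>2))" for n \<zeta>
  proof -
    have "Re (complex_of_real a * x) = a * Re x" for a x by simp
    then show ?thesis by (simp only: g_def Re_sum Re_half_plane_kernel)
  qed
  have P0: "P n (z n) \<noteq> 0" if "n \<in> A" for n
    using b[OF that] by (metis mult_zero_right norm_zero normP not_one_le_zero)
  have "f holomorphic_on upper_half_plane"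
    unfolding f_def F_def P_def g_def using fin P0 c(1)
    by (intro holomorphic_intros)
       (auto simp: upper_half_plane_def P_def dest: pos diff_cnj_ne_0)
  moreover have "f (z j) = w j" if j: "j \<in> A" for j
  proof -
    have "F n (z j) = 0" if "n \<in> A" "n \<noteq> j" for n
    proof -
      have "P n (z j) = 0"
        unfolding P_def using j that fin by (intro prod_zero) auto
      then show ?thesis by (simp add: F_def)
    qed
    moreover have "F j (z j) = 1"
    proof -
      have "z j - cnj (z j) = 2 * \<i> * Im (z j)" by (simp add: complex_eq_iff)
      then show ?thesis using P0[OF j] pos[OF j] by (simp add: F_def)
    qed
    ultimately have "f (z j) = (\<Sum>n\<in>A. if n = j then w j else 0)"
      unfolding f_def by (intro sum.cong) auto
    then show ?thesis using j fin by simp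
  qed
  moreover have "norm (f \<zeta>) \<le> exp 1 * c * W" if \<zeta>: "Im \<zeta> > 0" for \<zeta>
  proof -
    define t where "t k = 4 * (Im (z k))\<^sup>2 * b k / (norm (\<zeta> - cnj (z k)))\<^sup>2" for k
    have t0: "t k \<ge> 0" if "k \<in> A" for k
      using b0[OF that] by (simp add: t_def)
    have F_le: "norm (F n \<zeta>) \<le> exp 1 * (t n * exp (- (1/c) * (\<Sum>k\<in>{k\<in>A. Im (z k) \<le> Im (z n)}. t k)))"
      if n: "n \<in> A" for n
    proof -
      let ?L = "{k\<in>A. Im (z k) \<le> Im (z n)}"
      have "norm (P n \<zeta>) \<le> 1"
        unfolding P_def prod_norm[symmetric]
        using pos \<zeta> by (intro prod_le_1) (auto simp del: norm_divide intro: blaschke_factor_norm_le_1)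
      moreover have "1 / norm (P n (z n)) \<le> b n"
        using b[OF n] P0[OF n] by (simp add: normP[symmetric] divide_le_eq)
      ultimately have "norm (P n \<zeta>) * (1 / norm (P n (z n))) \<le> 1 * b n"
        by (rule mult_mono) auto
      then have 1: "norm (P n \<zeta> / P n (z n)) \<le> b n"
        by (simp add: norm_divide)
      have 2: "norm ((2 * \<i> * Im (z n) / (\<zeta> - cnj (z n)))\<^sup>2)
                 = 4 * (Im (z n))\<^sup>2 / (norm (\<zeta> - cnj (z n)))\<^sup>2"
        by (simp add: norm_power norm_divide norm_mult power_divide power_mult_distrib)
      have "Re (g n (z n)) = (\<Sum>j\<in>?L. 4 * Im (z j) * (Im (z j) + Im (z n))
               / (norm (z j - cnj (z n)))\<^sup>2 * b j)"
      proof -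
        have "norm (z n - cnj (z j)) = norm (z j - cnj (z n))" for j
          by (metis complex_cnj_cnj complex_cnj_diff complex_mod_cnj norm_minus_commute)
        then show ?thesis
          by (simp add: Re_g add_ac mult_ac)
      qed
      then have 3: "Re (g n (z n)) \<le> c" using c(2)[OF n] by simp
      \<comment> \<open>Dropping \<open>Im \<zeta>\<close> from the numerators gives a bound in the open half-plane directly,
          with no passage to boundary values.\<close>
      have "(\<Sum>k\<in>?L. t k) \<le> Re (g n \<zeta>)"
        unfolding Re_g
      proof (intro sum_mono)
        fix k assume "k \<in> ?L"
        then have k: "Im (z k) > 0" "b k > 0" using pos b0 by auto
        have "t k = 4 * Im (z k) * b k * (Im (z k) / (norm (\<zeta> - cnj (z k)))\<^sup>2)"
          by (simp add: t_def power2_eq_square)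
        also have "\<dots> \<le> 4 * Im (z k) * b k * ((Im \<zeta> + Im (z k)) / (norm (\<zeta> - cnj (z k)))\<^sup>2)"
          using k \<zeta> by (intro mult_left_mono divide_right_mono) auto
        finally show "t k \<le> \<dots>" .
      qed
      then have "Re ((g n (z n) - g n \<zeta>) / c) \<le> 1 + - (1/c) * (\<Sum>k\<in>?L. t k)"
      proof -
        assume "(\<Sum>k\<in>?L. t k) \<le> Re (g n \<zeta>)"
        then have "(Re (g n (z n)) - Re (g n \<zeta>)) / c \<le> (c - (\<Sum>k\<in>?L. t k)) / c"
          using 3 c(1) by (intro divide_right_mono) auto
        then show ?thesis using c(1) by (simp add: diff_divide_distrib)
      qed
      then have 4: "norm (exp ((g n (z n) - g n \<zeta>) / c))
           \<le> exp 1 * exp (- (1/c) * (\<Sum>k\<in>?L. t k))"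
        unfolding norm_exp_eq_Re exp_add[symmetric] by simp
      have "norm (F n \<zeta>) \<le> b n * (4 * (Im (z n))\<^sup>2 / (norm (\<zeta> - cnj (z n)))\<^sup>2)
           * (exp 1 * exp (- (1/c) * (\<Sum>k\<in>?L. t k)))"
        unfolding F_def norm_mult using 1 2 4 b0[OF n]
        by (intro mult_mono) auto
      then show ?thesis by (simp add: t_def mult_ac)
    qed
    have "norm (f \<zeta>) \<le> (\<Sum>n\<in>A. W * norm (F n \<zeta>))"
      unfolding f_def using w by (intro sum_norm_le) (auto simp: norm_mult intro: mult_right_mono)
    also have "\<dots> \<le> (\<Sum>n\<in>A. W * (exp 1 * (t n * exp (- (1/c) * (\<Sum>k\<in>{k\<in>A. Im (z k) \<le> Im (z n)}. t k)))))"
      using F_le w(2) by (intro sum_mono mult_left_mono) auto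
    also have "\<dots> = W * exp 1 * (\<Sum>n\<in>A. t n * exp (- (1/c) * (\<Sum>k\<in>{k\<in>A. Im (z k) \<le> Im (z n)}. t k)))"
      by (simp add: sum_distrib_left mult_ac)
    also have "\<dots> \<le> W * exp 1 * ((1 - exp (- (1/c) * (\<Sum>n\<in>A. t n))) / (1/c))"
      using w(2) c(1) fin t0 by (intro mult_left_mono ordered_exponential_sum_le) auto
    also have "\<dots> \<le> W * exp 1 * (1 / (1/c))"
      using w(2) c(1) by (intro mult_left_mono divide_right_mono) auto
    also have "\<dots> = exp 1 * c * W" by simp
    finally show ?thesis .
  qed
  ultimately show ?thesis by (rule that)
qed


section \<open>The upper bound for arbitrary sequences\<close>

lemma zero_in_indices:
  assumes "point_sequence N z"
  shows "0 \<in> indices N"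
  using assms by (simp add: point_sequence_def indices_def zero_enat_def[symmetric])

lemma blaschke_abs_le_partial:
  assumes seq: "point_sequence N z" and j: "j \<in> indices N"
  shows "blaschke_abs N z j
           \<le> (\<Prod>k\<in>{k\<in>indices N. k < m} - {j}. norm ((z j - z k) / (z j - cnj (z k))))"
proof -
  let ?X = "\<lambda>m. \<Prod>k\<in>{k \<in> indices N. k < m \<and> k \<noteq> j}. norm ((z j - z k) / (z j - cnj (z k)))"
  have pos: "Im (z k) > 0" if "k \<in> indices N" for k
    using seq that by (auto simp: point_sequence_def upper_half_plane_def)
  have le1: "norm ((z j - z k) / (z j - cnj (z k))) \<le> 1" if "k \<in> indices N" for k
    using pos[OF j] pos[OF that] by (rule blaschke_factor_norm_le_1)
  have X0: "?X m \<ge> 0" for m by (intro prod_nonneg) auto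
  have "decseq ?X"
  proof (rule decseq_SucI)
    fix m
    have factor: "?X (Suc m) \<le> ?X m" if m: "m \<in> indices N" "m \<noteq> j"
    proof -
      have "{k \<in> indices N. k < Suc m \<and> k \<noteq> j} = insert m {k \<in> indices N. k < m \<and> k \<noteq> j}"
        using m by auto
      then have "?X (Suc m) = norm ((z j - z m) / (z j - cnj (z m))) * ?X m"
        by (simp only: prod.insert) simp
      then show ?thesis
        using mult_right_mono[OF le1[OF m(1)] X0[of m]] by (simp only: mult_1_left)
    qed
    have no_factor: "?X (Suc m) = ?X m" if m: "\<not> (m \<in> indices N \<and> m \<noteq> j)"
    proof -
      have "{k \<in> indices N. k < Suc m \<and> k \<noteq> j} = {k \<in> indices N. k < m \<and> k \<noteq> j}"
        using m by (auto simp: less_Suc_eq)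
      then show ?thesis by simp
    qed
    show "?X (Suc m) \<le> ?X m"
    proof (cases "m \<in> indices N \<and> m \<noteq> j")
      case True
      then show ?thesis by (intro factor) auto
    next
      case False
      then show ?thesis by (intro eq_refl no_factor)
    qed
  qed
  then obtain L where L: "?X \<longlonglongrightarrow> L" "\<forall>i. L \<le> ?X i"
    using decseq_convergent X0 by blast
  have lim: "blaschke_abs N z j = L"
    unfolding blaschke_abs_def using L(1) by (rule limI)
  have "{k\<in>indices N. k < m} - {j} = {k \<in> indices N. k < m \<and> k \<noteq> j}" by auto
  then show "blaschke_abs N z j
           \<le> (\<Prod>k\<in>{k\<in>indices N. k < m} - {j}. norm ((z j - z k) / (z j - cnj (z k))))"
    using L(2) lim by simp
qed

lemma finite_sum_le_infsum_ennreal: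
  fixes f :: "'a \<Rightarrow> ennreal"
  assumes "finite B" "B \<subseteq> A"
  shows "sum f B \<le> infsum f A"
proof -
  have "infsum f B \<le> infsum f A"
    by (rule infsum_mono_neutral) (use assms in \<open>auto intro: nonneg_summable_on_complete\<close>)
  then show ?thesis using assms by simp
qed

lemma c_HJ_ge:
  assumes "n \<in> indices N" "finite B" "B \<subseteq> {j \<in> indices N. Im (z j) \<le> Im (z n)}"
  shows "(\<Sum>j\<in>B. ennreal (4 * Im (z j) * (Im (z j) + Im (z n)) / (norm (z j - cnj (z n)))\<^sup>2)
             * (1 / ennreal (blaschke_abs N z j))) \<le> c_HJ N z"
  unfolding c_HJ_def
  by (rule SUP_upper2[OF assms(1)]) (rule finite_sum_le_infsum_ennreal[OF assms(2,3)])

text \<open>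
  The reciprocal of the \<open>n\<close>-th Blaschke product enters the \<open>n\<close>-th sum with the coefficient \<open>2\<close>, so finiteness of the characteristic forces every
  Blaschke product to be nonzero.
\<close>

lemma diagonal_term:
  assumes "Im w > 0"
  shows "4 * Im w * (Im w + Im w) / (norm (w - cnj w))\<^sup>2 = 2"
  unfolding cmod_power2 using assms by (simp add: power2_eq_square)

lemma c_HJ_finite:
  assumes seq: "point_sequence N z" and c: "c_HJ N z = ennreal c"
  shows "c > 0"
    and "j \<in> indices N \<Longrightarrow> blaschke_abs N z j > 0"
    and "n \<in> indices N \<Longrightarrow> finite B \<Longrightarrow> B \<subseteq> {j \<in> indices N. Im (z j) \<le> Im (z n)} \<Longrightarrow>
      (\<Sum>j\<in>B. 4 * Im (z j) * (Im (z j) + Im (z n)) / (norm (z j - cnj (z n)))\<^sup>2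
             * (1 / blaschke_abs N z j)) \<le> c"
proof -
  have pos: "Im (z k) > 0" if "k \<in> indices N" for k
    using seq that by (auto simp: point_sequence_def upper_half_plane_def)
  have diag: "2 * (1 / ennreal (blaschke_abs N z j)) \<le> ennreal c" if "j \<in> indices N" for j
    using c_HJ_ge[of j N "{j}" z] that diagonal_term[OF pos[OF that]] by (simp add: c)
  have bpos: "blaschke_abs N z j > 0" if j: "j \<in> indices N" for j
  proof (rule ccontr)
    assume "\<not> blaschke_abs N z j > 0"
    then have "ennreal (blaschke_abs N z j) = 0" by (simp add: ennreal_neg)
    then show False
      using diag[OF j] by (simp add: ennreal_mult_top top_unique)
  qed
  show "j \<in> indices N \<Longrightarrow> blaschke_abs N z j > 0" by (rule bpos)
  have inv: "1 / ennreal (blaschke_abs N z j) = ennreal (1 / blaschke_abs N z j)"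
    if "j \<in> indices N" for j
    using divide_ennreal[of 1 "blaschke_abs N z j"] bpos[OF that] by simp
  obtain i where i: "i \<in> indices N"
    using zero_in_indices[OF seq] by blast
  show "c > 0"
  proof (rule ccontr)
    assume "\<not> c > 0"
    then have "ennreal c = 0" by (simp add: ennreal_neg)
    then have "1 / ennreal (blaschke_abs N z i) = 0" using diag[OF i] by simp
    then show False using bpos[OF i] by (simp add: inv[OF i] ennreal_eq_0_iff)
  qed
  assume n: "n \<in> indices N" and B: "finite B" "B \<subseteq> {j \<in> indices N. Im (z j) \<le> Im (z n)}"
  let ?f = "\<lambda>j. 4 * Im (z j) * (Im (z j) + Im (z n)) / (norm (z j - cnj (z n)))\<^sup>2
             * (1 / blaschke_abs N z j)"
  have f0: "?f j \<ge> 0" if "j \<in> B" for j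
  proof -
    have "j \<in> indices N" using that B by auto
    then show ?thesis using pos[of j] pos[OF n] bpos[of j] by simp
  qed
  have "ennreal (sum ?f B) = (\<Sum>j\<in>B. ennreal (?f j))"
    using f0 by simp
  also have "\<dots> = (\<Sum>j\<in>B. ennreal (4 * Im (z j) * (Im (z j) + Im (z n)) / (norm (z j - cnj (z n)))\<^sup>2)
             * (1 / ennreal (blaschke_abs N z j)))"
  proof (intro sum.cong refl)
    fix j assume "j \<in> B"
    then have j: "j \<in> indices N" using B by auto
    show "ennreal (?f j) = ennreal (4 * Im (z j) * (Im (z j) + Im (z n)) / (norm (z j - cnj (z n)))\<^sup>2)
             * (1 / ennreal (blaschke_abs N z j))"
      unfolding inv[OF j] using bpos[OF j] pos[OF j] pos[OF n] by (intro ennreal_mult) auto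
  qed
  also have "\<dots> \<le> ennreal c" using c_HJ_ge[OF n B] by (simp only: c)
  finally show "sum ?f B \<le> c" using \<open>c > 0\<close> by (simp add: ennreal_le_iff)
qed

text \<open>
  The interpolants of the initial segments obey one common bound, so they form a normal family. Each
  point lies in all but finitely many initial segments, so a limit function still takes the
  prescribed values.
\<close>

lemma interpolation_bound_of_c_HJ:
  assumes seq: "point_sequence N z" and c: "c_HJ N z = ennreal c"
  shows "interpolation_bound N z (exp 1 * c)"
  unfolding interpolation_bound_def
proof (intro allI impI)
  fix w :: "nat \<Rightarrow> complex" assume bdd: "bounded (w ` indices N)"
  define W where "W = (SUP j\<in>indices N. norm (w j))"
  have pos: "Im (z k) > 0" if "k \<in> indices N" for k
    using seq that by (auto simp: point_sequence_def upper_half_plane_def)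
  obtain i where i: "i \<in> indices N"
    using zero_in_indices[OF seq] by blast
  have "bdd_above ((\<lambda>j. norm (w j)) ` indices N)"
    using bdd by (auto simp: bounded_iff bdd_above_def)
  then have wW: "norm (w j) \<le> W" if "j \<in> indices N" for j
    unfolding W_def using that by (intro cSUP_upper)
  have W0: "W \<ge> 0" using wW[OF i] norm_ge_zero order_trans by blast
  define A where "A m = {k\<in>indices N. k < m}" for m
  have "\<exists>f. f holomorphic_on upper_half_plane \<and> (\<forall>j\<in>A m. f (z j) = w j) \<and>
     (\<forall>\<zeta>. Im \<zeta> > 0 \<longrightarrow> norm (f \<zeta>) \<le> exp 1 * c * W)" for m
  proof (rule finite_Jones_interpolation[of "A m" z "\<lambda>j. 1 / blaschke_abs N z j" c w W])
    show "finite (A m)" by (simp add: A_def)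
    show "inj_on z (A m)" using seq by (auto simp: point_sequence_def A_def inj_on_def)
    show "1 \<le> 1 / blaschke_abs N z j * (\<Prod>k\<in>A m - {j}. norm ((z j - z k) / (z j - cnj (z k))))"
      if "j \<in> A m" for j
    proof -
      have j: "j \<in> indices N" using that by (simp add: A_def)
      then show ?thesis
        using blaschke_abs_le_partial[OF seq j, of m] c_HJ_finite(2)[OF seq c j]
        by (simp add: A_def le_divide_eq)
    qed
    show "(\<Sum>j\<in>{j\<in>A m. Im (z j) \<le> Im (z n)}.
         4 * Im (z j) * (Im (z j) + Im (z n)) / (norm (z j - cnj (z n)))\<^sup>2 * (1 / blaschke_abs N z j)) \<le> c"
      if "n \<in> A m" for n
      using that by (intro c_HJ_finite(3)[OF seq c]) (auto simp: A_def)
  qed (use pos wW W0 c_HJ_finite(1)[OF seq c] in \<open>auto simp: A_def\<close>)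
  then obtain F where F: "\<And>m. F m holomorphic_on upper_half_plane"
      "\<And>m j. j \<in> A m \<Longrightarrow> F m (z j) = w j"
      "\<And>m \<zeta>. Im \<zeta> > 0 \<Longrightarrow> norm (F m \<zeta>) \<le> exp 1 * c * W"
    by metis
  have op: "open upper_half_plane"
    unfolding upper_half_plane_def by (rule open_halfspace_Im_gt)
  obtain f r where f: "f holomorphic_on upper_half_plane" "strict_mono (r :: nat \<Rightarrow> nat)"
      "\<And>\<zeta>. \<zeta> \<in> upper_half_plane \<Longrightarrow> (\<lambda>n. F (r n) \<zeta>) \<longlonglongrightarrow> f \<zeta>"
  proof (rule Montel[of upper_half_plane "range F" F])
    show "\<exists>B. \<forall>h\<in>range F. \<forall>\<zeta>\<in>K. norm (h \<zeta>) \<le> B" if "K \<subseteq> upper_half_plane" for K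
      using F(3) that by (intro exI[of _ "exp 1 * c * W"]) (auto simp: upper_half_plane_def)
  qed (use op F(1) in auto)
  have f_le: "norm (f \<zeta>) \<le> exp 1 * c * W" if "\<zeta> \<in> upper_half_plane" for \<zeta>
    using that F(3) by (intro LIMSEQ_le_const2[OF tendsto_norm[OF f(3)[OF that]]])
      (auto simp: upper_half_plane_def)
  have "f (z j) = w j" if j: "j \<in> indices N" for j
  proof (rule LIMSEQ_unique)
    show "(\<lambda>n. F (r n) (z j)) \<longlonglongrightarrow> f (z j)"
      using pos[OF j] by (intro f(3)) (simp add: upper_half_plane_def)
    have "F (r n) (z j) = w j" if "n \<ge> Suc j" for n
      using seq_suble[OF f(2), of n] that j by (intro F(2)) (auto simp: A_def)
    then show "(\<lambda>n. F (r n) (z j)) \<longlonglongrightarrow> w j"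
      by (intro tendsto_eventually eventually_sequentiallyI[of "Suc j"])
  qed
  moreover have "f \<in> H_infinity"
    using f(1) f_le by (auto simp: H_infinity_def bounded_iff)
  moreover have "H_infinity_norm f \<le> exp 1 * c * W"
    unfolding H_infinity_norm_def
  proof (rule cSUP_least)
    show "upper_half_plane \<noteq> {}" by (auto simp: upper_half_plane_def intro: exI[of _ \<i>])
  qed (use f_le in auto)
  ultimately show "\<exists>f\<in>H_infinity. (\<forall>j\<in>indices N. f (z j) = w j) \<and>
          H_infinity_norm f \<le> exp 1 * c * (SUP j\<in>indices N. norm (w j))"
    unfolding W_def by blast
qed

lemma HJ_constant_exp_1: "HJ_constant (exp 1)"
  unfolding HJ_constant_def
proof (intro allI impI)
  fix N z assume seq: "point_sequence N z"
  show "interpolation_constant N z \<le> ennreal (exp 1) * c_HJ N z"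
  proof (cases "c_HJ N z")
    case (real c)
    have b: "interpolation_bound N z (exp 1 * c)"
      using seq real(2) by (rule interpolation_bound_of_c_HJ)
    then have "interpolating N z"
      unfolding interpolating_def interpolation_bound_def by blast
    then have "interpolation_constant N z \<le> ennreal (exp 1 * c)"
      using b by (auto simp: interpolation_constant_def intro: INF_lower)
    then show ?thesis using real by (simp add: ennreal_mult)
  next
    case top
    then show ?thesis by (simp add: ennreal_mult_top)
  qed
qed

section \<open>Geometric progressions on the imaginary axis\<close>

text \<open>
  For the points \<open>i exp (l j)\<close> the pseudohyperbolic distance of the points with indices \<open>j\<close> and
  \<open>k\<close> is \<open>tanh (l |j - k| / 2)\<close>. This is therefore the Blaschke product of the first \<open>n\<close> neighbours on one side.
\<close>

definition tanh_product :: "real \<Rightarrow> nat \<Rightarrow> real" where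
  "tanh_product l n = (\<Prod>i<n. tanh (l * real (Suc i) / 2))"

lemma tanh_half_eq:
  "tanh ((x - y) / 2) = (exp x - exp y) / (exp x + exp y)" for x y :: real
proof -
  have e: "exp x = exp ((x + y) / 2) * exp ((x - y) / 2)"
          "exp y = exp ((x + y) / 2) * exp (- ((x - y) / 2))"
    unfolding exp_add[symmetric] by (simp_all add: field_simps)
  show ?thesis
    unfolding e tanh_altdef distrib_left[symmetric] right_diff_distrib[symmetric] by simp
qed

lemma tanh_product_pos:
  assumes "l > 0"
  shows "tanh_product l n > 0"
  using assms unfolding tanh_product_def by (intro prod_pos) auto

lemma decseq_tanh_product:
  assumes "l > 0"
  shows "decseq (tanh_product l)"
proof (rule decseq_SucI)
  fix n
  have "tanh_product l (Suc n) = tanh_product l n * tanh (l * real (Suc n) / 2)"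
    by (simp add: tanh_product_def)
  also have "\<dots> \<le> tanh_product l n * 1"
    using tanh_product_pos[OF assms, of n] by (intro mult_left_mono less_imp_le[OF tanh_real_lt_1]) auto
  finally show "tanh_product l (Suc n) \<le> tanh_product l n" by simp
qed

text \<open>
  The limit is positive because \<open>1 - tanh x\<close> decays exponentially. It is the one-sided Blaschke product
  of an infinite progression, so its square is the full product for the two-sided progression.
\<close>

lemma tanh_product_limit:
  assumes l: "l > 0"
  obtains q where "q > 0" "tanh_product l \<longlonglongrightarrow> q" "\<And>n. q \<le> tanh_product l n"
proof -
  define f where "f i = tanh (l * real (Suc i) / 2)" for i
  have "summable (\<lambda>i. norm (f i - 1))"
  proof (rule summable_comparison_test)
    show "summable (\<lambda>i. 2 * (exp (- l)) ^ i)"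
      using l by (intro summable_mult summable_geometric) auto
    have "norm (norm (f i - 1)) \<le> 2 * (exp (- l)) ^ i" for i
    proof -
      have "1 - f i = 2 / (exp (l * real (Suc i)) + 1)"
        using tanh_half_eq[of "l * real (Suc i)" 0] exp_gt_zero[of "l * real (Suc i)"]
        unfolding f_def by (simp add: field_simps add_pos_pos del: exp_gt_zero)
      also have "\<dots> \<le> 2 / exp (l * real i)"
        using l by (intro divide_left_mono) (auto simp: add_pos_pos intro!: add_increasing2)
      also have "\<dots> = 2 * (exp (- l)) ^ i"
        by (simp add: exp_of_nat_mult[symmetric] exp_minus field_simps)
      finally have "1 - f i \<le> 2 * (exp (- l)) ^ i" .
      moreover have "f i < 1" unfolding f_def by (rule tanh_real_lt_1)
      ultimately show ?thesis by simp
    qed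
    then show "\<exists>N. \<forall>n\<ge>N. norm (norm (f n - 1)) \<le> 2 * (exp (- l)) ^ n" by blast
  qed
  then have conv: "convergent_prod f"
    by (intro abs_convergent_prod_imp_convergent_prod summable_imp_abs_convergent_prod)
  have f0: "f i \<noteq> 0" for i using l by (simp add: f_def)
  have lim: "tanh_product l \<longlonglongrightarrow> prodinf f"
    unfolding tanh_product_def f_def[symmetric]
    using convergent_prod_LIMSEQ[OF conv] LIMSEQ_lessThan_iff_atMost by blast
  have "prodinf f \<noteq> 0" using conv f0 by (rule prodinf_nonzero)
  moreover have "prodinf f \<ge> 0"
    using tanh_product_pos[OF l] by (intro LIMSEQ_le_const[OF lim]) (auto intro: less_imp_le)
  moreover have "prodinf f \<le> tanh_product l n" for n
    using decseq_tanh_product[OF l] lim by (rule decseq_ge)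
  ultimately show ?thesis using lim by (intro that[of "prodinf f"]) auto
qed

text \<open>
  The points with index below \<open>j\<close> and those with index above \<open>j\<close> give one one-sided product each; the
  latter contribute the sign.
\<close>

lemma prod_tanh_difference:
  fixes l :: real
  assumes "j < N"
  shows "(\<Prod>k\<in>{..<N} - {j}. tanh ((l * real j - l * real k) / 2))
           = (- 1) ^ (N - 1 - j) * (tanh_product l j * tanh_product l (N - 1 - j))"
proof -
  let ?t = "\<lambda>k. tanh ((l * real j - l * real k) / 2)"
  have "{..<N} - {j} = {..<j} \<union> {Suc j..<N}" using assms by auto
  then have "prod ?t ({..<N} - {j}) = prod ?t ({..<j} \<union> {Suc j..<N})"
    by (rule arg_cong)
  also have "\<dots> = prod ?t {..<j} * prod ?t {Suc j..<N}"
    by (intro prod.union_disjoint) auto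
  also have "prod ?t {..<j} = tanh_product l j"
    unfolding tanh_product_def
  proof (rule prod.reindex_bij_witness[of _ "\<lambda>i. j - 1 - i" "\<lambda>k. j - 1 - k"])
    fix k assume "k \<in> {..<j}"
    then have "l * real j - l * real k = l * real (Suc (j - 1 - k))"
      by (simp add: of_nat_diff right_diff_distrib[symmetric])
    then show "tanh (l * real (Suc (j - 1 - k)) / 2) = ?t k" by (simp only:)
  qed auto
  also have "prod ?t {Suc j..<N} = (\<Prod>i<N - 1 - j. - tanh (l * real (Suc i) / 2))"
  proof (rule prod.reindex_bij_witness[of _ "\<lambda>i. Suc j + i" "\<lambda>k. k - Suc j"])
    fix k assume "k \<in> {Suc j..<N}"
    then have "l * real j - l * real k = - (l * real (Suc (k - Suc j)))"
      by (simp add: of_nat_diff algebra_simps)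
    then show "- tanh (l * real (Suc (k - Suc j)) / 2) = ?t k"
      by (simp only: minus_divide_left[symmetric] tanh_minus)
  qed auto
  also have "\<dots> = (- 1) ^ (N - 1 - j) * tanh_product l (N - 1 - j)"
    by (simp add: tanh_product_def prod_uminus)
  finally show ?thesis by (simp only: mult_ac)
qed

text \<open>
  The sum from \<open>k = 1\<close> is bounded by the integral of the decreasing function
  \<open>1 / (1 + exp (l t))\<close>, whose antiderivative is \<open>- ln (1 + exp (- l t)) / l\<close>. This is where \<open>ln 2\<close>
  comes from.
\<close>

lemma sum_logistic_le:
  fixes l :: real
  assumes l: "l > 0"
  shows "(\<Sum>k\<le>n. 1 / (1 + exp (l * real k))) \<le> 1 / 2 + ln 2 / l"
proof -
  define G where "G k = ln (1 + exp (- (l * real k)))" for k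
  have step: "1 / (1 + exp (l * real (Suc k))) \<le> (G k - G (Suc k)) / l" for k
  proof -
    let ?a = "l * real k" and ?b = "l * real (Suc k)"
    have "?a < ?b" using l by simp
    have "\<exists>t. ?a < t \<and> t < ?b \<and> ln (1 + exp (- ?b)) - ln (1 + exp (- ?a))
             = (?b - ?a) * (- exp (- t) / (1 + exp (- t)))"
      using \<open>?a < ?b\<close>
      by (intro MVT2) (auto intro!: derivative_eq_intros simp: add_pos_pos)
    then obtain t where t: "?a < t" "t < ?b" and
      "ln (1 + exp (- ?b)) - ln (1 + exp (- ?a)) = (?b - ?a) * (- exp (- t) / (1 + exp (- t)))"
      by blast
    then have "G k - G (Suc k) = l * (exp (- t) / (1 + exp (- t)))"
      by (simp add: G_def algebra_simps)
    also have "exp (- t) / (1 + exp (- t)) = 1 / (1 + exp t)"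
      by (simp add: exp_minus field_simps)
    finally have "(G k - G (Suc k)) / l = 1 / (1 + exp t)" using l by simp
    moreover have "1 / (1 + exp ?b) \<le> 1 / (1 + exp t)"
      using t by (intro divide_left_mono) (auto simp: add_pos_pos)
    ultimately show ?thesis by simp
  qed
  have "(\<Sum>k\<le>n. 1 / (1 + exp (l * real k))) = 1 / 2 + (\<Sum>k<n. 1 / (1 + exp (l * real (Suc k))))"
    by (simp add: sum.atMost_shift)
  also have "(\<Sum>k<n. 1 / (1 + exp (l * real (Suc k)))) \<le> (\<Sum>k<n. (G k - G (Suc k)) / l)"
    by (intro sum_mono step)
  also have "\<dots> = (G 0 - G n) / l"
    by (simp add: sum_divide_distrib[symmetric] sum_lessThan_telescope')
  also have "\<dots> \<le> ln 2 / l"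
    using l by (intro divide_right_mono) (auto simp: G_def)
  finally show ?thesis by simp
qed

definition geometric_points :: "real \<Rightarrow> nat \<Rightarrow> complex" where
  "geometric_points l j = \<i> * complex_of_real (exp (l * real j))"

lemma geometric_points_simps [simp]:
  "Re (geometric_points l j) = 0" "Im (geometric_points l j) = exp (l * real j)"
  by (simp_all add: geometric_points_def)

lemma point_sequence_geometric:
  assumes "l > 0" "N > 0"
  shows "point_sequence (enat N) (geometric_points l)"
proof -
  have "inj_on (geometric_points l) A" for A
    using assms by (auto simp: inj_on_def complex_eq_iff)
  then show ?thesis
    using assms by (auto simp: point_sequence_def upper_half_plane_def zero_enat_def)
qed

lemma indices_enat: "indices (enat N) = {..<N}"
  by (auto simp: indices_def)

lemma blaschke_factor_geometric:
  "(geometric_points l j - geometric_points l k) / (geometric_points l j - cnj (geometric_points l k))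
     = complex_of_real (tanh ((l * real j - l * real k) / 2))"
proof -
  have "geometric_points l j - geometric_points l k
          = \<i> * complex_of_real (exp (l * real j) - exp (l * real k))"
       "geometric_points l j - cnj (geometric_points l k)
          = \<i> * complex_of_real (exp (l * real j) + exp (l * real k))"
    by (simp_all add: complex_eq_iff)
  then show ?thesis
    unfolding tanh_half_eq by (simp add: of_real_divide[symmetric] del: of_real_divide of_real_add of_real_diff)
qed

lemma blaschke_abs_geometric:
  assumes l: "l > 0" and j: "j < N"
  shows "blaschke_abs (enat N) (geometric_points l) j
           = tanh_product l j * tanh_product l (N - 1 - j)"
proof -
  let ?z = "geometric_points l"
  have "(\<Prod>k\<in>{k \<in> indices (enat N). k < m \<and> k \<noteq> j}. norm ((?z j - ?z k) / (?z j - cnj (?z k))))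
          = tanh_product l j * tanh_product l (N - 1 - j)" if "m \<ge> N" for m
  proof -
    have "{k \<in> indices (enat N). k < m \<and> k \<noteq> j} = {..<N} - {j}"
      using that by (auto simp: indices_enat)
    then have "(\<Prod>k\<in>{k \<in> indices (enat N). k < m \<and> k \<noteq> j}. norm ((?z j - ?z k) / (?z j - cnj (?z k))))
        = \<bar>\<Prod>k\<in>{..<N} - {j}. tanh ((l * real j - l * real k) / 2)\<bar>"
      by (simp only: blaschke_factor_geometric norm_of_real abs_prod)
    also have "\<dots> = tanh_product l j * tanh_product l (N - 1 - j)"
      unfolding prod_tanh_difference[OF j]
      using tanh_product_pos[OF l] by (simp add: abs_mult power_abs less_imp_le)
    finally show ?thesis .
  qed
  then show ?thesis
    unfolding blaschke_abs_def
    by (intro limI tendsto_eventually eventually_sequentiallyI[of N])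
qed

lemma c_HJ_geometric_le:
  assumes l: "l > 0" and q: "q > 0" "\<And>n. q \<le> tanh_product l n"
  shows "c_HJ (enat N) (geometric_points l) \<le> ennreal (4 * (1 / 2 + ln 2 / l) / q\<^sup>2)"
  unfolding c_HJ_def
proof (rule SUP_least)
  let ?z = "geometric_points l"
  fix n assume "n \<in> indices (enat N)"
  then have n: "n < N" by (simp add: indices_enat)
  have "{j \<in> indices (enat N). Im (?z j) \<le> Im (?z n)} = {..n}"
    using n l by (auto simp: indices_enat)
  moreover have "ennreal (4 * Im (?z j) * (Im (?z j) + Im (?z n)) / (norm (?z j - cnj (?z n)))\<^sup>2)
        * (1 / ennreal (blaschke_abs (enat N) ?z j))
      \<le> ennreal (4 / q\<^sup>2 * (1 / (1 + exp (l * real (n - j)))))" if "j \<le> n" for j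
  proof -
    have j: "j < N" using that n by simp
    let ?b = "tanh_product l j * tanh_product l (N - 1 - j)"
    let ?x = "exp (l * real j)" and ?y = "exp (l * real n)"
    have xy: "?x + ?y > 0" by (simp add: add_pos_pos)
    have "(norm (?z j - cnj (?z n)))\<^sup>2 = (?x + ?y)\<^sup>2"
      by (simp add: cmod_power2)
    then have "4 * Im (?z j) * (Im (?z j) + Im (?z n)) / (norm (?z j - cnj (?z n)))\<^sup>2 = 4 * (?x / (?x + ?y))"
      using xy by (simp add: power2_eq_square)
    also have "?x / (?x + ?y) = 1 / (1 + ?y / ?x)"
      by (simp add: field_simps)
    also have "?y / ?x = exp (l * real (n - j))"
      using that by (simp add: exp_diff[symmetric] of_nat_diff algebra_simps)
    finally have 1: "4 * Im (?z j) * (Im (?z j) + Im (?z n)) / (norm (?z j - cnj (?z n)))\<^sup>2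
        = 4 * (1 / (1 + exp (l * real (n - j))))" .
    have "q\<^sup>2 \<le> ?b"
      unfolding power2_eq_square using q tanh_product_pos[OF l] by (intro mult_mono) (auto intro: less_imp_le)
    moreover have "?b > 0" using tanh_product_pos[OF l] by simp
    ultimately have 2: "1 / ennreal ?b \<le> ennreal (1 / q\<^sup>2)"
      using divide_ennreal[of 1 ?b] q(1) by (simp add: ennreal_leI frac_le)
    have "ennreal (4 * (1 / (1 + exp (l * real (n - j))))) * (1 / ennreal ?b)
        \<le> ennreal (4 * (1 / (1 + exp (l * real (n - j))))) * ennreal (1 / q\<^sup>2)"
      using 2 by (rule mult_left_mono) simp
    also have "\<dots> = ennreal (4 / q\<^sup>2 * (1 / (1 + exp (l * real (n - j)))))"
      by (subst ennreal_mult[symmetric]) (auto simp: add_nonneg_nonneg less_imp_le mult_ac)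
    finally show ?thesis
      unfolding 1 blaschke_abs_geometric[OF l j] .
  qed
  ultimately have "(\<Sum>\<^sub>\<infinity>j\<in>{j \<in> indices (enat N). Im (?z j) \<le> Im (?z n)}.
        ennreal (4 * Im (?z j) * (Im (?z j) + Im (?z n)) / (norm (?z j - cnj (?z n)))\<^sup>2)
          * (1 / ennreal (blaschke_abs (enat N) ?z j)))
      \<le> (\<Sum>j\<le>n. ennreal (4 / q\<^sup>2 * (1 / (1 + exp (l * real (n - j))))))"
    by (simp only: infsum_finite finite_atMost) (intro sum_mono; simp)
  also have "\<dots> = ennreal (\<Sum>j\<le>n. 4 / q\<^sup>2 * (1 / (1 + exp (l * real (n - j)))))"
    by (intro sum_ennreal) (auto simp: add_nonneg_nonneg)
  also have "(\<Sum>j\<le>n. 4 / q\<^sup>2 * (1 / (1 + exp (l * real (n - j)))))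
      = 4 / q\<^sup>2 * (\<Sum>k\<le>n. 1 / (1 + exp (l * real k)))"
    unfolding sum_distrib_left[symmetric]
    by (subst sum.nat_diff_reindex[symmetric, of _ "Suc n", simplified lessThan_Suc_atMost]) simp
  also have "ennreal \<dots> \<le> ennreal (4 / q\<^sup>2 * (1 / 2 + ln 2 / l))"
    using sum_logistic_le[OF l] by (intro ennreal_leI mult_left_mono) auto
  finally show "(\<Sum>\<^sub>\<infinity>j\<in>{j \<in> indices (enat N). Im (?z j) \<le> Im (?z n)}.
        ennreal (4 * Im (?z j) * (Im (?z j) + Im (?z n)) / (norm (?z j - cnj (?z n)))\<^sup>2)
          * (1 / ennreal (blaschke_abs (enat N) ?z j)))
      \<le> ennreal (4 * (1 / 2 + ln 2 / l) / q\<^sup>2)" by simp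
qed

section \<open>A contour integral in the logarithmic strip\<close>

lemma norm_contour_integral_rectpath_le:
  assumes le: "Re a \<le> Re b" "Im a \<le> Im b"
    and cont: "continuous_on (path_image (rectpath a b)) F"
    and H: "H \<ge> 0" "\<And>\<zeta>. Re \<zeta> \<in> {Re a..Re b} \<Longrightarrow> Im \<zeta> \<in> {Im a, Im b} \<Longrightarrow> norm (F \<zeta>) \<le> H"
    and V: "V \<ge> 0" "\<And>\<zeta>. Re \<zeta> \<in> {Re a, Re b} \<Longrightarrow> Im \<zeta> \<in> {Im a..Im b} \<Longrightarrow> norm (F \<zeta>) \<le> V"
  shows "norm (contour_integral (rectpath a b) F)
           \<le> 2 * H * (Re b - Re a) + 2 * V * (Im b - Im a)"
proof -
  define p where "p = Complex (Re b) (Im a)"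
  define r where "r = Complex (Re a) (Im b)"
  have img: "path_image (rectpath a b) = closed_segment a p \<union> closed_segment p b
               \<union> closed_segment b r \<union> closed_segment r a"
    by (simp add: rectpath_def Let_def path_image_join p_def r_def Un_assoc)
  have int: "F contour_integrable_on linepath a p" "F contour_integrable_on linepath p b"
            "F contour_integrable_on linepath b r" "F contour_integrable_on linepath r a"
    using cont unfolding img
    by (auto intro!: contour_integrable_continuous_linepath elim!: continuous_on_subset)
  have "contour_integral (rectpath a b) F
          = contour_integral (linepath a p) F + (contour_integral (linepath p b) F
            + (contour_integral (linepath b r) F + contour_integral (linepath r a) F))"
    unfolding rectpath_def Let_def p_def[symmetric] r_def[symmetric]
    using int by (simp add: contour_integral_join contour_integrable_join valid_path_join)
  also have "norm \<dots> \<le> H * norm (p - a) + (V * norm (b - p) + (H * norm (r - b) + V * norm (a - r)))"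
  proof (intro norm_triangle_le add_mono contour_integral_bound_linepath int H(1) V(1))
    show "norm (F \<zeta>) \<le> H" if "\<zeta> \<in> closed_segment a p" for \<zeta>
      using that le by (intro H(2)) (auto simp: p_def closed_segment_same_Im closed_segment_eq_real_ivl)
    show "norm (F \<zeta>) \<le> V" if "\<zeta> \<in> closed_segment p b" for \<zeta>
      using that le by (intro V(2)) (auto simp: p_def closed_segment_same_Re closed_segment_eq_real_ivl)
    show "norm (F \<zeta>) \<le> H" if "\<zeta> \<in> closed_segment b r" for \<zeta>
      using that le
      by (intro H(2)) (auto simp: r_def closed_segment_same_Im closed_segment_eq_real_ivl split: if_splits)
    show "norm (F \<zeta>) \<le> V" if "\<zeta> \<in> closed_segment r a" for \<zeta>
      using that le
      by (intro V(2)) (auto simp: r_def closed_segment_same_Re closed_segment_eq_real_ivl split: if_splits)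
  qed
  finally have le_sides: "norm (contour_integral (rectpath a b) F)
    \<le> H * norm (p - a) + (V * norm (b - p) + (H * norm (r - b) + V * norm (a - r)))" .
  have sides: "norm (p - a) = Re b - Re a" "norm (b - p) = Im b - Im a"
            "norm (r - b) = Re b - Re a" "norm (a - r) = Im b - Im a"
    using le by (simp_all add: p_def r_def cmod_def)
  show ?thesis using le_sides unfolding sides by (simp add: algebra_simps)
qed

text \<open>The Blaschke factor with zero \<open>i exp a\<close>, in the coordinate \<open>\<zeta>\<close> with \<open>z = exp \<zeta>\<close>.\<close>

definition log_blaschke_factor :: "real \<Rightarrow> complex \<Rightarrow> complex" where
  "log_blaschke_factor a \<zeta> = (exp \<zeta> - \<i> * of_real (exp a)) / (exp \<zeta> + \<i> * of_real (exp a))"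

text \<open>
  Numerator and denominator of the squared modulus share the factor \<open>2 exp (Re \<zeta> + a)\<close>, since
  \<open>exp (2 x) + exp (2 a) = 2 exp (x + a) cosh (x - a)\<close>. Both lower bounds below come from this formula: in
  the strip, where \<open>sin (Im \<zeta>)\<close> lies between \<open>0\<close> and \<open>1\<close>, the quotient increases with \<open>cosh\<close>, which is
  at least \<open>1\<close>, and decreases with \<open>sin\<close>.
\<close>

lemma norm_log_blaschke_factor:
  "(norm (log_blaschke_factor a \<zeta>))\<^sup>2
     = (cosh (Re \<zeta> - a) - sin (Im \<zeta>)) / (cosh (Re \<zeta> - a) + sin (Im \<zeta>))"
proof -
  let ?x = "Re \<zeta>" and ?s = "sin (Im \<zeta>)" and ?c = "cos (Im \<zeta>)"
  have c: "2 * exp ?x * exp a * cosh (?x - a) = (exp ?x)\<^sup>2 + (exp a)\<^sup>2"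
    by (simp add: cosh_def exp_diff exp_minus field_simps power2_eq_square)
  have sc: "?s\<^sup>2 + ?c\<^sup>2 = 1" by simp
  have "(norm (exp \<zeta> - \<i> * of_real (exp a)))\<^sup>2
          = (exp ?x * ?c)\<^sup>2 + (exp ?x * ?s - exp a)\<^sup>2"
    by (simp add: cmod_power2 Re_exp Im_exp)
  also have "\<dots> = (exp ?x)\<^sup>2 * (?s\<^sup>2 + ?c\<^sup>2) + (exp a)\<^sup>2 - 2 * exp ?x * exp a * ?s"
    by algebra
  finally have num: "(norm (exp \<zeta> - \<i> * of_real (exp a)))\<^sup>2 = 2 * exp ?x * exp a * (cosh (?x - a) - ?s)"
    unfolding sc right_diff_distrib c by simp
  have "(norm (exp \<zeta> + \<i> * of_real (exp a)))\<^sup>2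
          = (exp ?x * ?c)\<^sup>2 + (exp ?x * ?s + exp a)\<^sup>2"
    by (simp add: cmod_power2 Re_exp Im_exp)
  also have "\<dots> = (exp ?x)\<^sup>2 * (?s\<^sup>2 + ?c\<^sup>2) + (exp a)\<^sup>2 + 2 * exp ?x * exp a * ?s"
    by algebra
  finally have den: "(norm (exp \<zeta> + \<i> * of_real (exp a)))\<^sup>2 = 2 * exp ?x * exp a * (cosh (?x - a) + ?s)"
    unfolding sc distrib_left c by simp
  show ?thesis
    unfolding log_blaschke_factor_def norm_divide power_divide num den by simp
qed

lemma log_blaschke_factor_denominator:
  assumes "0 < Im \<zeta>" "Im \<zeta> < pi"
  shows "exp \<zeta> + \<i> * of_real (exp a) \<noteq> 0"
proof
  assume "exp \<zeta> + \<i> * of_real (exp a) = 0"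
  then have "Im (exp \<zeta> + \<i> * of_real (exp a)) = 0" by simp
  moreover have "Im (exp \<zeta>) > 0" using assms by (simp add: Im_exp sin_gt_zero)
  moreover have "Im (\<i> * complex_of_real (exp a)) > 0" by simp
  ultimately show False by (simp only: plus_complex.sel)
qed

lemma log_blaschke_factor_eq_0_iff:
  assumes "0 < Im \<zeta>" "Im \<zeta> < pi"
  shows "log_blaschke_factor a \<zeta> = 0 \<longleftrightarrow> \<zeta> = Complex a (pi / 2)"
proof -
  have "exp (Complex a (pi / 2)) = \<i> * of_real (exp a)"
    by (simp add: exp_eq_polar complex_eq_iff)
  moreover have "exp \<zeta> = exp (Complex a (pi / 2)) \<longleftrightarrow> \<zeta> = Complex a (pi / 2)"
    using assms by (auto intro!: exp_complex_eqI)
  ultimately show ?thesis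
    using log_blaschke_factor_denominator[OF assms, of a] by (simp add: log_blaschke_factor_def)
qed

lemma diff_over_add_antimono:
  fixes c s c' s' :: real
  assumes "0 < c'" "c' \<le> c" "0 \<le> s" "s \<le> s'"
  shows "(c' - s') / (c' + s') \<le> (c - s) / (c + s)"
proof -
  have "s * c' \<le> s' * c" using assms by (intro mult_mono) auto
  then show ?thesis
    using assms by (subst frac_le_eq) (auto simp: divide_le_0_iff algebra_simps)
qed

lemma log_blaschke_factor_ge_horizontal:
  assumes "sin (Im \<zeta>) = s" "0 \<le> s"
  shows "sqrt ((1 - s) / (1 + s)) \<le> norm (log_blaschke_factor a \<zeta>)"
proof -
  have "(1 - s) / (1 + s) \<le> (norm (log_blaschke_factor a \<zeta>))\<^sup>2"
    unfolding norm_log_blaschke_factor assms(1)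
    using assms(2) cosh_real_ge_1[of "Re \<zeta> - a"] by (intro diff_over_add_antimono) auto
  then show ?thesis by (rule real_le_lsqrt[rotated]) auto
qed

lemma log_blaschke_factor_ge_vertical:
  assumes "0 \<le> sin (Im \<zeta>)"
  shows "tanh (\<bar>Re \<zeta> - a\<bar> / 2) \<le> norm (log_blaschke_factor a \<zeta>)"
proof -
  let ?u = "Re \<zeta> - a"
  have "2 * (?u / 2) = ?u" by simp
  then have u: "cosh ?u = 2 * (cosh (?u / 2))\<^sup>2 - 1"
    using cosh_double_cosh[of "?u / 2"] by (simp only:)
  have "\<bar>?u\<bar> / 2 = \<bar>?u / 2\<bar>" by simp
  then have "(tanh (\<bar>?u\<bar> / 2))\<^sup>2 = (tanh (?u / 2))\<^sup>2"
    by (simp only: tanh_real_abs power2_abs)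
  also have "\<dots> = (sinh (?u / 2))\<^sup>2 / (cosh (?u / 2))\<^sup>2"
    by (simp only: tanh_def power_divide)
  also have "\<dots> = (2 * (sinh (?u / 2))\<^sup>2) / (2 * (cosh (?u / 2))\<^sup>2)"
    by simp
  also have "\<dots> = (cosh ?u - 1) / (cosh ?u + 1)"
    using u cosh_square_eq[of "?u / 2"] by simp
  also have "\<dots> \<le> (norm (log_blaschke_factor a \<zeta>))\<^sup>2"
    unfolding norm_log_blaschke_factor
    using assms cosh_real_ge_1[of ?u] by (intro diff_over_add_antimono) auto
  finally show ?thesis by (rule power2_le_imp_le) simp
qed

lemma log_blaschke_factor_at_node:
  "log_blaschke_factor a (Complex x (pi / 2)) = of_real (tanh ((x - a) / 2))"
proof -
  have "exp (Complex x (pi / 2)) = \<i> * of_real (exp x)"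
    by (simp add: exp_eq_polar complex_eq_iff)
  then have "log_blaschke_factor a (Complex x (pi / 2))
      = (\<i> * of_real (exp x - exp a)) / (\<i> * of_real (exp x + exp a))"
    by (simp add: log_blaschke_factor_def algebra_simps)
  then show ?thesis
    unfolding tanh_half_eq by (simp add: of_real_divide[symmetric] del: of_real_divide of_real_add of_real_diff)
qed

text \<open>
  The derivative at the zero does not depend on \<open>a\<close>, because dilations of the half-plane are
  translations of the strip.
\<close>

lemma has_field_derivative_log_blaschke_factor:
  "(log_blaschke_factor a has_field_derivative 1 / 2) (at (Complex a (pi / 2)))"
proof -
  let ?p = "Complex a (pi / 2)"
  have e: "exp ?p = \<i> * of_real (exp a)"
    by (simp add: exp_eq_polar complex_eq_iff)
  have "((\<lambda>\<zeta>. (exp \<zeta> - exp ?p) / (exp \<zeta> + exp ?p)) has_field_derivative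
      (exp ?p * (exp ?p + exp ?p) - (exp ?p - exp ?p) * exp ?p) / ((exp ?p + exp ?p) * (exp ?p + exp ?p))) (at ?p)"
    by (intro derivative_eq_intros) auto
  moreover have "(exp ?p * (exp ?p + exp ?p) - (exp ?p - exp ?p) * exp ?p) / ((exp ?p + exp ?p) * (exp ?p + exp ?p)) = 1 / 2"
    by (simp add: field_simps)
  ultimately show ?thesis
    unfolding log_blaschke_factor_def[abs_def] e by simp
qed

definition log_blaschke :: "real \<Rightarrow> nat \<Rightarrow> complex \<Rightarrow> complex" where
  "log_blaschke l N \<zeta> = (\<Prod>k<N. log_blaschke_factor (l * real k) \<zeta>)"

lemma log_blaschke_holomorphic:
  "log_blaschke l N holomorphic_on {\<zeta>. 0 < Im \<zeta> \<and> Im \<zeta> < pi}"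
  unfolding log_blaschke_def[abs_def] log_blaschke_factor_def[abs_def]
  by (intro holomorphic_intros) (auto dest: log_blaschke_factor_denominator)

lemma log_blaschke_ge_horizontal:
  assumes "sin (Im \<zeta>) = s" "0 \<le> s" "s \<le> 1"
  shows "sqrt ((1 - s) / (1 + s)) ^ N \<le> norm (log_blaschke l N \<zeta>)"
proof -
  have "(\<Prod>k<N. sqrt ((1 - s) / (1 + s))) \<le> (\<Prod>k<N. norm (log_blaschke_factor (l * real k) \<zeta>))"
    using assms by (intro prod_mono conjI log_blaschke_factor_ge_horizontal) auto
  then show ?thesis by (simp add: log_blaschke_def prod_norm)
qed

text \<open>
  Each factor after the first exceeds the factor of the one-sided product with index one less. So the
  product is bounded below independently of \<open>N\<close>, which keeps the short sides of the rectangle harmless.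
\<close>

lemma prod_tanh_half_integers_ge:
  assumes l: "l > 0" and q: "q \<ge> 0" "\<And>n. q \<le> tanh_product l n"
  shows "tanh (l / 4) * q \<le> (\<Prod>k<N. tanh (l * (real k + 1 / 2) / 2))"
proof (cases N)
  case 0
  have "tanh (l / 4) * q \<le> 1 * 1"
    using q(2)[of 0] q(1) l by (intro mult_mono less_imp_le[OF tanh_real_lt_1]) (auto simp: tanh_product_def)
  then show ?thesis using 0 by simp
next
  case (Suc n)
  have "tanh_product l n \<le> (\<Prod>k<n. tanh (l * (real (Suc k) + 1 / 2) / 2))"
    unfolding tanh_product_def using l by (intro prod_mono) auto
  then have "q \<le> (\<Prod>k<n. tanh (l * (real (Suc k) + 1 / 2) / 2))" using q(2)[of n] by simp
  then have "tanh (l / 4) * q \<le> tanh (l / 4) * (\<Prod>k<n. tanh (l * (real (Suc k) + 1 / 2) / 2))"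
    using l by (intro mult_left_mono) auto
  then show ?thesis unfolding Suc prod.lessThan_Suc_shift by simp
qed

lemma log_blaschke_ge_vertical:
  assumes l: "l > 0" and q: "q \<ge> 0" "\<And>n. q \<le> tanh_product l n"
    and x: "Re \<zeta> = - l / 2 \<or> Re \<zeta> = l * (real N - 1 / 2)" and s: "0 \<le> sin (Im \<zeta>)"
  shows "tanh (l / 4) * q \<le> norm (log_blaschke l N \<zeta>)"
proof -
  have "(\<Prod>k<N. tanh (\<bar>Re \<zeta> - l * real k\<bar> / 2)) \<le> norm (log_blaschke l N \<zeta>)"
    unfolding log_blaschke_def prod_norm[symmetric]
    using s by (intro prod_mono conjI log_blaschke_factor_ge_vertical) auto
  moreover have "(\<Prod>k<N. tanh (\<bar>Re \<zeta> - l * real k\<bar> / 2)) = (\<Prod>k<N. tanh (l * (real k + 1 / 2) / 2))"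
    using x
  proof
    assume x: "Re \<zeta> = - l / 2"
    have "\<bar>Re \<zeta> - l * real k\<bar> = l * (real k + 1 / 2)" for k
    proof -
      have "Re \<zeta> - l * real k = - (l * (real k + 1 / 2))" by (simp add: x algebra_simps)
      then show ?thesis using l by (simp add: abs_mult)
    qed
    then show ?thesis by simp
  next
    assume x: "Re \<zeta> = l * (real N - 1 / 2)"
    have "\<bar>Re \<zeta> - l * real k\<bar> = l * (real (N - Suc k) + 1 / 2)" if "k < N" for k
    proof -
      have "Re \<zeta> - l * real k = l * (real (N - Suc k) + 1 / 2)"
        using that by (simp add: x of_nat_diff algebra_simps)
      then show ?thesis using l by (simp add: abs_mult)
    qed
    then have "(\<Prod>k<N. tanh (\<bar>Re \<zeta> - l * real k\<bar> / 2)) = (\<Prod>k<N. tanh (l * (real (N - Suc k) + 1 / 2) / 2))"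
      by (intro prod.cong) auto
    also have "\<dots> = (\<Prod>k<N. tanh (l * (real k + 1 / 2) / 2))"
      by (rule prod.nat_diff_reindex)
    finally show ?thesis .
  qed
  ultimately show ?thesis
    using prod_tanh_half_integers_ge[OF l q, of N] by simp
qed

lemma log_blaschke_derivative:
  assumes "j < N"
  shows "(log_blaschke l N has_field_derivative
            of_real ((- 1) ^ (N - 1 - j) * (tanh_product l j * tanh_product l (N - 1 - j)) / 2))
          (at (Complex (l * real j) (pi / 2)))"
proof -
  let ?p = "Complex (l * real j) (pi / 2)"
  define R where "R \<zeta> = (\<Prod>k\<in>{..<N} - {j}. log_blaschke_factor (l * real k) \<zeta>)" for \<zeta>
  have B: "log_blaschke l N = (\<lambda>\<zeta>. log_blaschke_factor (l * real j) \<zeta> * R \<zeta>)"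
    using assms by (auto simp: log_blaschke_def R_def fun_eq_iff intro: prod.remove)
  have "R holomorphic_on {\<zeta>. 0 < Im \<zeta> \<and> Im \<zeta> < pi}"
    unfolding R_def[abs_def] log_blaschke_factor_def[abs_def]
    by (intro holomorphic_intros) (auto dest: log_blaschke_factor_denominator)
  moreover have "open {\<zeta>. 0 < Im \<zeta> \<and> Im \<zeta> < pi}"
    by (intro open_Collect_conj open_halfspace_Im_gt open_halfspace_Im_lt)
  ultimately have "(R has_field_derivative deriv R ?p) (at ?p)"
    by (rule holomorphic_derivI) auto
  from DERIV_mult[OF has_field_derivative_log_blaschke_factor this]
  have "(log_blaschke l N has_field_derivative 1 / 2 * R ?p) (at ?p)"
    unfolding B by (simp add: log_blaschke_factor_at_node)
  moreover have "R ?p = of_real ((- 1) ^ (N - 1 - j) * (tanh_product l j * tanh_product l (N - 1 - j)))"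
    unfolding R_def log_blaschke_factor_at_node of_real_prod[symmetric] prod_tanh_difference[OF assms] ..
  ultimately show ?thesis by simp
qed

text \<open>
  The residue theorem on the rectangle that leaves a margin \<open>\<delta>\<close> to the boundary of the strip, where
  \<open>f\<close> may be undefined, and a margin \<open>l / 2\<close> to the first and the last zero. The prescribed
  values have the signs of the derivatives of the Blaschke product, so that all residues add up.
\<close>

lemma sum_inverse_tanh_products_le_contour:
  assumes l: "l > 0" and q: "q > 0" "\<And>n. q \<le> tanh_product l n"
    and f: "f holomorphic_on upper_half_plane" "\<And>\<zeta>. Im \<zeta> > 0 \<Longrightarrow> norm (f \<zeta>) \<le> C"
    and fz: "\<And>j. j < N \<Longrightarrow> f (geometric_points l j) = (- 1) ^ (N - 1 - j)"
    and \<delta>: "0 < \<delta>" "\<delta> < pi / 2"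
  shows "4 * pi * (\<Sum>j<N. 1 / (tanh_product l j * tanh_product l (N - 1 - j)))
    \<le> 2 * (C / sqrt ((1 - sin \<delta>) / (1 + sin \<delta>)) ^ N) * (l * real N)
        + 2 * (C / (tanh (l / 4) * q)) * (pi - 2 * \<delta>)"
proof -
  define S where "S = {\<zeta>. 0 < Im \<zeta> \<and> Im \<zeta> < pi}"
  define a where "a = Complex (- l / 2) \<delta>"
  define b where "b = Complex (l * (real N - 1 / 2)) (pi - \<delta>)"
  define p where "p j = Complex (l * real j) (pi / 2)" for j
  define F where "F \<zeta> = f (exp \<zeta>) / log_blaschke l N \<zeta>" for \<zeta>
  define D where "D j = tanh_product l j * tanh_product l (N - 1 - j)" for j
  have D0: "D j > 0" for j using tanh_product_pos[OF l] by (simp add: D_def)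
  have C0: "C \<ge> 0" by (rule order_trans[OF norm_ge_zero f(2)[of \<i>]]) simp
  have ab: "Re a \<le> Re b" "Im a \<le> Im b"
    using l \<delta> by (auto simp: a_def b_def algebra_simps)
  have opS: "open S" unfolding S_def
    by (intro open_Collect_conj open_halfspace_Im_gt open_halfspace_Im_lt)
  have "convex S"
  proof -
    have "S = {\<zeta>. Im \<zeta> > 0} \<inter> {\<zeta>. Im \<zeta> < pi}" by (auto simp: S_def)
    then show ?thesis by (simp add: convex_Int convex_halfspace_Im_gt convex_halfspace_Im_lt)
  qed
  then have connS: "connected S" by (rule convex_connected)
  have exp_in: "exp ` S \<subseteq> upper_half_plane"
    by (auto simp: S_def upper_half_plane_def Im_exp sin_gt_zero)
  have fexp: "(\<lambda>\<zeta>. f (exp \<zeta>)) holomorphic_on S"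
    using holomorphic_on_compose_gen[OF holomorphic_on_exp f(1) exp_in] by (simp add: o_def)
  have Bhol: "log_blaschke l N holomorphic_on S"
    unfolding S_def by (rule log_blaschke_holomorphic)
  have B0: "\<zeta> \<in> p ` {..<N}" if "\<zeta> \<in> S" "log_blaschke l N \<zeta> = 0" for \<zeta>
    using that by (auto simp: S_def log_blaschke_def p_def log_blaschke_factor_eq_0_iff)
  have Fhol: "F holomorphic_on S - p ` {..<N}"
    unfolding F_def using B0
    by (intro holomorphic_on_divide holomorphic_on_subset[OF fexp] holomorphic_on_subset[OF Bhol]) auto
  have p_box: "p j \<in> box a b" if "j < N" for j
  proof -
    have "real j + 1 \<le> real N" using that by simp
    then have "l * real j < l * (real N - 1 / 2)" using l by simp
    moreover have "- l / 2 < l * real j" by (rule less_le_trans[of _ 0]) (use l in auto)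
    ultimately show ?thesis
      using l \<delta> by (auto simp: p_def a_def b_def in_box_complex_iff)
  qed
  have path_sub: "path_image (rectpath a b) \<subseteq> S - p ` {..<N}"
  proof -
    have "cbox a b \<subseteq> S" using \<delta> by (auto simp: S_def in_cbox_complex_iff a_def b_def)
    then show ?thesis
      unfolding path_image_rectpath_cbox_minus_box[OF ab] using p_box by auto
  qed
  have "contour_integral (rectpath a b) F
          = 2 * pi * \<i> * (\<Sum>x\<in>p ` {..<N}. winding_number (rectpath a b) x * residue F x)"
  proof (rule Residue_theorem[OF opS connS _ Fhol])
    show "\<forall>\<zeta>. \<zeta> \<notin> S \<longrightarrow> winding_number (rectpath a b) \<zeta> = 0"
    proof (intro allI impI winding_number_rectpath_outside ab)
      fix \<zeta> assume "\<zeta> \<notin> S"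
      then show "\<zeta> \<notin> cbox a b" using \<delta> by (auto simp: S_def in_cbox_complex_iff a_def b_def)
    qed
  qed (use path_sub in auto)
  also have "(\<Sum>x\<in>p ` {..<N}. winding_number (rectpath a b) x * residue F x)
      = (\<Sum>j<N. winding_number (rectpath a b) (p j) * residue F (p j))"
    using l by (intro sum.reindex_cong[of p]) (auto simp: inj_on_def p_def)
  also have "\<dots> = (\<Sum>j<N. of_real (2 / D j))"
  proof (intro sum.cong refl)
    fix j assume "j \<in> {..<N}"
    then have j: "j < N" by simp
    let ?sgn = "(- 1) ^ (N - 1 - j) :: real"
    have ez: "exp (p j) = geometric_points l j"
      by (simp add: p_def geometric_points_def exp_eq_polar complex_eq_iff)
    have sgn: "(- 1) ^ (N - 1 - j) = complex_of_real ?sgn" by simp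
    have "residue F (p j) = f (exp (p j)) / of_real (?sgn * D j / 2)"
      unfolding F_def[abs_def]
    proof (rule residue_simple_pole_deriv[OF fexp Bhol opS connS])
      show "p j \<in> S" by (simp add: S_def p_def)
      show "(log_blaschke l N has_field_derivative complex_of_real (?sgn * D j / 2)) (at (p j))"
        unfolding p_def D_def by (rule log_blaschke_derivative[OF j])
      show "f (exp (p j)) \<noteq> 0" by (simp add: ez fz[OF j])
      show "complex_of_real (?sgn * D j / 2) \<noteq> 0" using D0[of j] by simp
      show "log_blaschke l N (p j) = 0"
        unfolding log_blaschke_def using j
        by (intro prod_zero bexI[of _ j]) (auto simp: p_def log_blaschke_factor_at_node)
    qed
    also have "\<dots> = of_real (?sgn / (?sgn * D j / 2))"
      unfolding ez fz[OF j] sgn by (simp only: of_real_divide)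
    also have "?sgn / (?sgn * D j / 2) = 2 / D j" by simp
    finally show "winding_number (rectpath a b) (p j) * residue F (p j) = of_real (2 / D j)"
      using winding_number_rectpath[OF p_box[OF j]] by simp
  qed
  finally have "contour_integral (rectpath a b) F = \<i> * of_real (4 * pi * (\<Sum>j<N. 1 / D j))"
    by (simp add: sum_distrib_left mult_ac)
  then have "norm (contour_integral (rectpath a b) F) = \<bar>4 * pi * (\<Sum>j<N. 1 / D j)\<bar>"
    by (simp only: norm_mult norm_of_real) simp
  then have eq: "4 * pi * (\<Sum>j<N. 1 / D j) \<le> norm (contour_integral (rectpath a b) F)"
    by simp
  let ?h = "sqrt ((1 - sin \<delta>) / (1 + sin \<delta>)) ^ N" and ?k = "tanh (l / 4) * q"
  have "sin \<delta> < sin (pi / 2)" using \<delta> by (intro sin_monotone_2pi) auto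
  moreover have "sin \<delta> > 0" using \<delta> by (intro sin_gt_zero) auto
  ultimately have s: "0 < sin \<delta>" "sin \<delta> < 1" by simp_all
  have h0: "?h > 0" and k0: "?k > 0" using s l q(1) by simp_all
  have F_le: "norm (F \<zeta>) \<le> C / m" if "\<zeta> \<in> S" "m \<le> norm (log_blaschke l N \<zeta>)" "m > 0" for \<zeta> m
  proof -
    have "Im (exp \<zeta>) > 0" using exp_in that(1) by (auto simp: upper_half_plane_def)
    then show ?thesis
      unfolding F_def norm_divide using that C0 by (intro frac_le f(2)) auto
  qed
  have "norm (contour_integral (rectpath a b) F)
      \<le> 2 * (C / ?h) * (Re b - Re a) + 2 * (C / ?k) * (Im b - Im a)"
  proof (rule norm_contour_integral_rectpath_le[OF ab])
    show "continuous_on (path_image (rectpath a b)) F"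
      using Fhol path_sub holomorphic_on_imp_continuous_on continuous_on_subset by blast
    show "C / ?h \<ge> 0" "C / ?k \<ge> 0" using C0 h0 k0 by simp_all
    fix \<zeta>
    {
      assume "Re \<zeta> \<in> {Re a..Re b}" and im: "Im \<zeta> \<in> {Im a, Im b}"
      have "\<zeta> \<in> S" using im \<delta> by (auto simp: S_def a_def b_def)
      moreover have "sin (Im \<zeta>) = sin \<delta>" using im by (auto simp: a_def b_def)
      then have "?h \<le> norm (log_blaschke l N \<zeta>)"
        using s by (intro log_blaschke_ge_horizontal) auto
      ultimately show "norm (F \<zeta>) \<le> C / ?h" using h0 by (intro F_le)
    }
    {
      assume re: "Re \<zeta> \<in> {Re a, Re b}" and im: "Im \<zeta> \<in> {Im a..Im b}"
      have \<zeta>S: "\<zeta> \<in> S" using im \<delta> by (auto simp: S_def a_def b_def)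
      have "?k \<le> norm (log_blaschke l N \<zeta>)"
      proof (rule log_blaschke_ge_vertical[OF l less_imp_le[OF q(1)] q(2)])
        show "Re \<zeta> = - l / 2 \<or> Re \<zeta> = l * (real N - 1 / 2)" using re by (auto simp: a_def b_def)
        show "0 \<le> sin (Im \<zeta>)" using \<zeta>S by (intro sin_ge_zero) (auto simp: S_def)
      qed
      then show "norm (F \<zeta>) \<le> C / ?k" using \<zeta>S k0 by (intro F_le)
    }
  qed
  also have "Re b - Re a = l * real N" by (simp add: a_def b_def algebra_simps)
  also have "Im b - Im a = pi - 2 * \<delta>" by (simp add: a_def b_def)
  finally show ?thesis using eq by (simp add: D_def)
qed

text \<open>The margin \<open>\<delta>\<close> tends to \<open>0\<close> with \<open>N\<close> fixed, so the lower bound for \<open>|B|\<close> on the long sides tends to \<open>1\<close>.\<close>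

lemma sum_inverse_tanh_products_le:
  assumes l: "l > 0" and q: "q > 0" "\<And>n. q \<le> tanh_product l n"
    and f: "f holomorphic_on upper_half_plane" "\<And>\<zeta>. Im \<zeta> > 0 \<Longrightarrow> norm (f \<zeta>) \<le> C"
    and fz: "\<And>j. j < N \<Longrightarrow> f (geometric_points l j) = (- 1) ^ (N - 1 - j)"
  shows "4 * pi * (\<Sum>j<N. 1 / (tanh_product l j * tanh_product l (N - 1 - j)))
    \<le> C * (2 * l * real N + 2 * pi / (tanh (l / 4) * q))"
proof (rule tendsto_lowerbound)
  have "((\<lambda>\<delta>. 2 * (C / sqrt ((1 - sin \<delta>) / (1 + sin \<delta>)) ^ N) * (l * real N)
        + 2 * (C / (tanh (l / 4) * q)) * (pi - 2 * \<delta>)) \<longlongrightarrow>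
      2 * (C / sqrt ((1 - sin 0) / (1 + sin 0)) ^ N) * (l * real N)
        + 2 * (C / (tanh (l / 4) * q)) * (pi - 2 * 0)) (at_right 0)"
    by (intro tendsto_intros) (use l q in auto)
  then show "((\<lambda>\<delta>. 2 * (C / sqrt ((1 - sin \<delta>) / (1 + sin \<delta>)) ^ N) * (l * real N)
        + 2 * (C / (tanh (l / 4) * q)) * (pi - 2 * \<delta>)) \<longlongrightarrow>
      C * (2 * l * real N + 2 * pi / (tanh (l / 4) * q))) (at_right 0)"
    by (simp add: algebra_simps)
  have "eventually (\<lambda>\<delta>::real. \<delta> \<in> {0<..<pi / 2}) (at_right 0)"
    by (rule eventually_at_right_real) simp
  then show "\<forall>\<^sub>F \<delta> in at_right 0. 4 * pi * (\<Sum>j<N. 1 / (tanh_product l j * tanh_product l (N - 1 - j)))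
      \<le> 2 * (C / sqrt ((1 - sin \<delta>) / (1 + sin \<delta>)) ^ N) * (l * real N)
        + 2 * (C / (tanh (l / 4) * q)) * (pi - 2 * \<delta>)"
    by eventually_elim (intro sum_inverse_tanh_products_le_contour[OF l q f fz]; simp)
qed simp

section \<open>The lower bound\<close>

lemma interpolation_bound_geometric_ge:
  assumes l: "l > 0" and N: "N > 0" and q: "q > 0" "\<And>n. q \<le> tanh_product l n"
    and C: "interpolation_bound (enat N) (geometric_points l) C"
  shows "4 * pi * (\<Sum>j<N. 1 / (tanh_product l j * tanh_product l (N - 1 - j)))
    \<le> C * (2 * l * real N + 2 * pi / (tanh (l / 4) * q))"
proof -
  let ?w = "\<lambda>j. (- 1) ^ (N - 1 - j) :: complex"
  have "bounded (?w ` indices (enat N))" by (simp add: indices_enat finite_imp_bounded)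
  then obtain f where f: "f \<in> H_infinity" "\<And>j. j < N \<Longrightarrow> f (geometric_points l j) = ?w j"
    and fn: "H_infinity_norm f \<le> C * (SUP j\<in>indices (enat N). norm (?w j))"
    using C unfolding interpolation_bound_def indices_enat by (metis lessThan_iff)
  have "(SUP j\<in>indices (enat N). norm (?w j)) = 1"
    using N by (simp add: indices_enat norm_power cSUP_const lessThan_empty_iff)
  then have "H_infinity_norm f \<le> C" using fn by simp
  moreover have "norm (f \<zeta>) \<le> H_infinity_norm f" if "Im \<zeta> > 0" for \<zeta>
  proof -
    have "bdd_above ((\<lambda>\<zeta>. norm (f \<zeta>)) ` upper_half_plane)"
      using f(1) by (auto simp: H_infinity_def bounded_iff bdd_above_def)
    then show ?thesis
      unfolding H_infinity_norm_def using that by (intro cSUP_upper) (auto simp: upper_half_plane_def)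
  qed
  ultimately have "norm (f \<zeta>) \<le> C" if "Im \<zeta> > 0" for \<zeta> using that by force
  then show ?thesis
    using f by (intro sum_inverse_tanh_products_le[OF l q]) (auto simp: H_infinity_def)
qed

text \<open>
  A negative \<open>k\<close> acts as \<open>0\<close> in \<open>ennreal k\<close>; hence the maximum. Negative constants
  are excluded at the end, by the positivity of the lower bound.
\<close>

lemma HJ_constant_geometric_bound:
  assumes k: "HJ_constant k" and l: "l > 0" and N: "N > 0"
    and q: "q > 0" "\<And>n. q \<le> tanh_product l n"
  shows "4 * pi * (\<Sum>j<N. 1 / (tanh_product l j * tanh_product l (N - 1 - j)))
    \<le> max 0 k * (4 * (1 / 2 + ln 2 / l) / q\<^sup>2) * (2 * l * real N + 2 * pi / (tanh (l / 4) * q))"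
proof -
  let ?z = "geometric_points l"
  let ?S = "4 * pi * (\<Sum>j<N. 1 / (tanh_product l j * tanh_product l (N - 1 - j)))"
  let ?d = "2 * l * real N + 2 * pi / (tanh (l / 4) * q)"
  let ?c = "4 * (1 / 2 + ln 2 / l) / q\<^sup>2"
  have d: "?d > 0" using l N q(1) by (simp add: add_pos_pos)
  have c: "?c \<ge> 0" using l by simp
  have "interpolation_constant (enat N) ?z \<le> ennreal k * c_HJ (enat N) ?z"
    using k point_sequence_geometric[OF l N] unfolding HJ_constant_def by blast
  also have "\<dots> \<le> ennreal k * ennreal ?c"
    by (intro mult_left_mono c_HJ_geometric_le l q) auto
  also have "\<dots> = ennreal (max 0 k) * ennreal ?c"
    by (simp add: max_def ennreal_neg)
  also have "\<dots> = ennreal (max 0 k * ?c)"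
    using c by (intro ennreal_mult[symmetric]) auto
  finally have le: "interpolation_constant (enat N) ?z \<le> ennreal (max 0 k * ?c)" .
  then have "interpolating (enat N) ?z"
    by (auto simp: interpolation_constant_def top_unique split: if_splits)
  then have "interpolation_constant (enat N) ?z = (INF C\<in>{C. interpolation_bound (enat N) ?z C}. ennreal C)"
    by (simp add: interpolation_constant_def)
  also have "\<dots> \<ge> ennreal (?S / ?d)"
  proof (rule INF_greatest)
    fix C assume "C \<in> {C. interpolation_bound (enat N) ?z C}"
    then have "?S \<le> C * ?d" using interpolation_bound_geometric_ge[OF l N q] by simp
    then show "ennreal (?S / ?d) \<le> ennreal C" using d by (intro ennreal_leI) (simp add: divide_le_eq)
  qed
  finally have "ennreal (?S / ?d) \<le> ennreal (max 0 k * ?c)" using le by (rule order_trans)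
  then have "?S / ?d \<le> max 0 k * ?c"
    by (subst (asm) ennreal_le_iff) (intro mult_nonneg_nonneg c max.cobounded1)
  then show ?thesis using d by (simp only: pos_divide_le_eq)
qed

text \<open>
  Points at distance at least \<open>J\<close> from both ends have at least \<open>J\<close> neighbours on each side. Cutting off the
  others costs a number of terms independent of \<open>N\<close>.
\<close>

lemma sum_inverse_tanh_products_ge:
  assumes l: "l > 0"
  shows "(real N - 2 * real J) / (tanh_product l J)\<^sup>2
           \<le> (\<Sum>j<N. 1 / (tanh_product l j * tanh_product l (N - 1 - j)))"
proof -
  let ?Q = "tanh_product l"
  have Q0: "?Q n > 0" for n by (rule tanh_product_pos[OF l])
  have "(real N - 2 * real J) / (?Q J)\<^sup>2 \<le> real (card {J..<N - J}) * (1 / (?Q J)\<^sup>2)"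
    by (simp add: divide_right_mono)
  also have "\<dots> = (\<Sum>j\<in>{J..<N - J}. 1 / (?Q J)\<^sup>2)" by simp
  also have "\<dots> \<le> (\<Sum>j\<in>{J..<N - J}. 1 / (?Q j * ?Q (N - 1 - j)))"
  proof (intro sum_mono)
    fix j assume "j \<in> {J..<N - J}"
    then have "?Q j \<le> ?Q J" "?Q (N - 1 - j) \<le> ?Q J"
      using decseq_tanh_product[OF l] by (auto simp: decseq_def)
    then have "?Q j * ?Q (N - 1 - j) \<le> (?Q J)\<^sup>2"
      unfolding power2_eq_square using Q0 by (intro mult_mono) (auto intro: less_imp_le)
    then show "1 / (?Q J)\<^sup>2 \<le> 1 / (?Q j * ?Q (N - 1 - j))"
      using Q0 by (intro frac_le) auto
  qed
  also have "\<dots> \<le> (\<Sum>j<N. 1 / (?Q j * ?Q (N - 1 - j)))"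
    using Q0 by (intro sum_mono2) (auto intro: less_imp_le)
  finally show ?thesis .
qed

text \<open>
  Two limits: \<open>N \<rightarrow> \<infinity>\<close> with the cut-off \<open>J\<close> fixed removes the boundary terms, and then \<open>J \<rightarrow> \<infinity>\<close>
  replaces the finite Blaschke product by its limit \<open>q\<close>. The powers of \<open>q\<close> on the two sides cancel.
\<close>

lemma HJ_constant_ge_at_scale:
  assumes k: "HJ_constant k" and l: "l > 0"
  shows "pi \<le> max 0 k * (l + 2 * ln 2)"
proof -
  obtain q where q: "q > 0" "tanh_product l \<longlonglongrightarrow> q" "\<And>n. q \<le> tanh_product l n"
    using tanh_product_limit[OF l] by blast
  let ?c = "4 * (1 / 2 + ln 2 / l) / q\<^sup>2" and ?e = "2 * pi / (tanh (l / 4) * q)"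
  define u where "u n = 1 / real (Suc n)" for n
  have u0: "u \<longlonglongrightarrow> 0"
    unfolding u_def[abs_def] using LIMSEQ_inverse_real_of_nat by (simp add: inverse_eq_divide)
  have fixed_cut: "4 * pi * (1 / (tanh_product l J)\<^sup>2) \<le> max 0 k * ?c * (2 * l)" for J
  proof (rule LIMSEQ_le)
    show "(\<lambda>n. 4 * pi * ((1 - 2 * real J * (u n)) / (tanh_product l J)\<^sup>2))
        \<longlonglongrightarrow> 4 * pi * (1 / (tanh_product l J)\<^sup>2)"
      using tanh_product_pos[OF l, of J] u0
      by (auto intro!: tendsto_eq_intros)
    show "(\<lambda>n. max 0 k * ?c * (2 * l + ?e * (u n))) \<longlonglongrightarrow> max 0 k * ?c * (2 * l)"
      using u0 l q by (auto intro!: tendsto_eq_intros)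
    have "4 * pi * ((1 - 2 * real J * (u n)) / (tanh_product l J)\<^sup>2)
        \<le> max 0 k * ?c * (2 * l + ?e * (u n))" for n
    proof -
      let ?N = "Suc n"
      have "4 * pi * ((real ?N - 2 * real J) / (tanh_product l J)\<^sup>2)
          \<le> max 0 k * ?c * (2 * l * real ?N + ?e)"
        using sum_inverse_tanh_products_ge[OF l, of ?N J]
          HJ_constant_geometric_bound[OF k l _ q(1,3), of ?N]
        by (meson mult_left_mono order_trans pi_ge_zero zero_le_mult_iff zero_le_numeral zero_less_Suc)
      then have "4 * pi * ((real ?N - 2 * real J) / (tanh_product l J)\<^sup>2) / real ?N
          \<le> max 0 k * ?c * (2 * l * real ?N + ?e) / real ?N"
        by (rule divide_right_mono) simp
      moreover have "4 * pi * ((real ?N - 2 * real J) / (tanh_product l J)\<^sup>2) / real ?N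
          = 4 * pi * ((1 - 2 * real J * (1 / real ?N)) / (tanh_product l J)\<^sup>2)"
        by (simp add: field_simps del: of_nat_Suc)
      moreover have "(2 * l * real ?N + ?e) / real ?N = 2 * l + ?e * (1 / real ?N)"
        by (simp add: add_divide_distrib del: of_nat_Suc)
      ultimately show ?thesis unfolding u_def by (simp only: times_divide_eq_right[symmetric])
    qed
    then show "\<exists>N. \<forall>n\<ge>N. 4 * pi * ((1 - 2 * real J * (u n)) / (tanh_product l J)\<^sup>2)
        \<le> max 0 k * ?c * (2 * l + ?e * (u n))" by blast
  qed
  have "4 * pi * (1 / q\<^sup>2) \<le> max 0 k * ?c * (2 * l)"
  proof (rule LIMSEQ_le_const2)
    show "(\<lambda>J. 4 * pi * (1 / (tanh_product l J)\<^sup>2)) \<longlonglongrightarrow> 4 * pi * (1 / q\<^sup>2)"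
      using q by (intro tendsto_intros) auto
  qed (use fixed_cut in blast)
  then have "4 * pi * (1 / q\<^sup>2) * q\<^sup>2 \<le> max 0 k * ?c * (2 * l) * q\<^sup>2"
    by (rule mult_right_mono) simp
  also have "max 0 k * ?c * (2 * l) * q\<^sup>2 = max 0 k * (?c * (2 * l) * q\<^sup>2)"
    by (simp only: mult.assoc)
  also have "?c * (2 * l) * q\<^sup>2 = 4 * (l + 2 * ln 2)"
    using q(1) l by (simp add: field_simps)
  also have "max 0 k * (4 * (l + 2 * ln 2)) = 4 * (max 0 k * (l + 2 * ln 2))"
    by (simp only: mult.left_commute)
  finally show ?thesis using q(1) by simp
qed

lemma HJ_constant_ge:
  assumes "HJ_constant k"
  shows "pi / ln 4 \<le> k"
proof -
  have "pi \<le> max 0 k * (0 + 2 * ln 2)"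
  proof (rule tendsto_lowerbound)
    show "((\<lambda>l. max 0 k * (l + 2 * ln 2)) \<longlongrightarrow> max 0 k * (0 + 2 * ln 2)) (at_right 0)"
      by (intro tendsto_intros)
    show "\<forall>\<^sub>F l in at_right 0. pi \<le> max 0 k * (l + 2 * ln 2)"
      using eventually_at_right_less[of 0]
      by eventually_elim (rule HJ_constant_ge_at_scale[OF assms])
  qed simp
  moreover have "ln 4 = 2 * ln (2::real)" using ln_realpow[of 2 2] by simp
  ultimately have "pi \<le> max 0 k * ln 4" by simp
  then have "pi / ln 4 \<le> max 0 k" by (simp add: divide_le_eq)
  moreover have "pi / ln 4 > 0" by simp
  ultimately show ?thesis by linarith
qed


section \<open>The smallest constant\<close>

text \<open>
  If the characteristic is finite it is positive, and dividing by it shows that the condition on \<open>k\<close> is a lower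
  bound for \<open>k\<close>, which passes to the infimum. If it is infinite, positivity of the infimum
  is essential, because \<open>0 \<cdot> \<infinity> = 0\<close> in \<^typ>\<open>ennreal\<close>.
\<close>

lemma HJ_constant_Inf:
  assumes k0: "HJ_constant k0" and pos: "l > 0" "\<And>k. HJ_constant k \<Longrightarrow> l \<le> k"
  shows "HJ_constant (Inf {k. HJ_constant k})"
proof -
  let ?K = "{k. HJ_constant k}"
  have "interpolation_constant N z \<le> ennreal (Inf ?K) * c_HJ N z"
    if seq: "point_sequence N z" for N z
  proof -
    have le: "interpolation_constant N z \<le> ennreal k * c_HJ N z" if "k \<in> ?K" for k
      using that seq by (auto simp: HJ_constant_def)
    have Inf: "l \<le> Inf ?K" using k0 pos(2) by (intro cInf_greatest) auto
    show ?thesis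
    proof (cases "c_HJ N z")
      case (real c)
      have c: "c > 0" using c_HJ_finite(1)[OF seq real(2)] .
      have le': "interpolation_constant N z \<le> ennreal (k * c)" if "k \<in> ?K" for k
        using le[OF that] pos that real by (simp add: ennreal_mult order.trans[of 0 l k])
      obtain m where m: "m \<ge> 0" "interpolation_constant N z = ennreal m"
        using le'[of k0] k0 by (cases "interpolation_constant N z") (auto simp: top_unique)
      have "m / c \<le> Inf ?K"
      proof (rule cInf_greatest)
        fix k assume k: "k \<in> ?K"
        then have "k * c \<ge> 0" using pos c by (intro mult_nonneg_nonneg) (auto intro: order.trans[of 0 l k])
        then have "m \<le> k * c" using le'[OF k] m by simp
        then show "m / c \<le> k" using c by (simp add: divide_le_eq)
      qed (use k0 in auto)
      then have "m \<le> Inf ?K * c" using c by (simp add: divide_le_eq)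
      then show ?thesis using m real Inf pos(1) by (simp add: ennreal_mult[symmetric] ennreal_leI)
    next
      case top
      then show ?thesis using Inf pos(1) by (simp add: ennreal_mult_top ennreal_eq_0_iff)
    qed
  qed
  then show ?thesis by (subst HJ_constant_def) blast
qed

theorem theorem2:
  "\<exists>k::real. HJ_constant k \<and> (\<forall>k'. HJ_constant k' \<longrightarrow> k \<le> k') \<and> k \<in> {pi / ln 4 .. exp 1}"
proof (intro exI conjI allI impI)
  let ?K = "{k. HJ_constant k}"
  have bdd: "bdd_below ?K" using HJ_constant_ge by (auto simp: bdd_below_def)
  show "HJ_constant (Inf ?K)"
    by (rule HJ_constant_Inf[OF HJ_constant_exp_1 _ HJ_constant_ge]) auto
  show "Inf ?K \<le> k'" if "HJ_constant k'" for k'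
    using that bdd by (intro cInf_lower) auto
  show "Inf ?K \<in> {pi / ln 4 .. exp 1}"
    using bdd HJ_constant_exp_1 HJ_constant_ge by (auto intro: cInf_lower cInf_greatest)
qed

end
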